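(* For every $2 \leqslant s \leqslant t$, there exists a constant $C = C(s,t) > 0$ such that, for every function $p = p(n) \in [0,1]$, with high probability as $n \to \infty$, $$\mathrm{ex}\big(G(n,p), K_{s,t}\big) \leqslant \begin{cases} C\, n^{2-(s+t-2)/(st-1)} (\log n)^2 & \text{if } p \leqslant n^{-(s-1)/(st-1)} (\log n)^{2s/(s-1)}, \\ C\, p^{(s-1)/s} n^{2-1/s} & \text{otherwise.}\end{cases}$$
   Context: $G(n,p)$ is the Erdős–Rényi random graph on $n$ vertices with edge probability $p$. For a graph $\Gamma$, $\mathrm{ex}(\Gamma, K_{s,t})$ is the maximum number of edges of a $K_{s,t}$-free subgraph of $\Gamma$, where $K_{s,t}$ is the complete bipartite graph with parts of sizes $s$ and $t$. "With high probability" means with probability tending to $1$. *)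

theory Defs
  imports "HOL-Probability.Probability" "HOL-Probability.Product_PMF"
begin

type_synonym 'a graph = "'a set \<times> 'a set set"

abbreviation verts :: "'a graph \<Rightarrow> 'a set" where "verts \<equiv> fst"
abbreviation edges :: "'a graph \<Rightarrow> 'a set set" where "edges \<equiv> snd"

definition all_pairs :: "'a set \<Rightarrow> 'a set set" where
  "all_pairs V = {e. e \<subseteq> V \<and> card e = 2}"

definition simple_graph :: "'a graph \<Rightarrow> bool" where
  "simple_graph G \<longleftrightarrow> finite (verts G) \<and> edges G \<subseteq> all_pairs (verts G)"

definition is_subgraph :: "'a graph \<Rightarrow> 'a graph \<Rightarrow> bool" where
  "is_subgraph H G \<longleftrightarrow> simple_graph H \<and> verts H \<subseteq> verts G \<and> edges H \<subseteq> edges G"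

(* Some subgraph of G, not necessarily induced, is isomorphic to H. *)
definition contains_copy :: "'a graph \<Rightarrow> 'b graph \<Rightarrow> bool" where
  "contains_copy G H \<longleftrightarrow>
     (\<exists>f. inj_on f (verts H) \<and> f ` verts H \<subseteq> verts G \<and> (\<forall>e\<in>edges H. f ` e \<in> edges G))"

definition complete_bipartite :: "nat \<Rightarrow> nat \<Rightarrow> (nat + nat) graph" where
  "complete_bipartite s t =
     (Inl ` {..<s} \<union> Inr ` {..<t}, {{Inl i, Inr j} | i j. i < s \<and> j < t})"

(* For a finite graph G and an H with at least one edge, the maximum is over a finite
   nonempty set. *)
definition ex_number :: "'a graph \<Rightarrow> 'b graph \<Rightarrow> nat" where
  "ex_number G H = Max {card (edges G') | G'. is_subgraph G' G \<and> \<not> contains_copy G' H}"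

(* Each pair of vertices is an edge independently with probability p; the argument False of
   Pi_pmf is only the value outside the index set. Only meaningful for p in [0,1]. *)
definition gnp :: "nat \<Rightarrow> real \<Rightarrow> nat graph pmf" where
  "gnp n p = map_pmf (\<lambda>f. ({1..n}, {e \<in> all_pairs {1..n}. f e}))
               (Pi_pmf (all_pairs {1..n}) False (\<lambda>_. bernoulli_pmf p))"

definition whp :: "(nat \<Rightarrow> 'a pmf) \<Rightarrow> (nat \<Rightarrow> 'a \<Rightarrow> bool) \<Rightarrow> bool" where
  "whp M P \<longleftrightarrow> (\<lambda>n. measure_pmf.prob (M n) {x. P n x}) \<longlonglongrightarrow> 1"

end

theory Submission
  imports Defs "HOL-Real_Asymp.Real_Asymp"
begin

text \<open>
  It suffices to bound the generating function \<open>Z(A) = \<Sum> q^|I|\<close> over the $K_{s,t}$-free sets of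
  edges \<open>I \<subseteq> A\<close> for \<open>q = e p\<close>, since the probability that \<open>G(n,p)\<close> has a $K_{s,t}$-free
  subgraph with more than \<open>x\<close> edges is at most \<open>e^(-x) Z(K_n)\<close>. A container step replaces \<open>Z(A)\<close> by
  \<open>Z(A')\<close> with \<open>|A'| \<le> (1 - \<delta>)|A|\<close> at the cost of a sum over small fingerprints \<open>T \<subseteq> A\<close>. It is
  iterated until \<open>|A|\<close> drops below \<open>K = const p^(-1/s) n^(2-1/s)\<close>, where \<open>Z(A) \<le> e^(q|A|)\<close> is
  good enough. The costs of the steps form a geometric series dominated by \<open>p K\<close>, plus a term
  \<open>n^(2-(s+t-2)/(st-1)) log n\<close> for each of the \<open>O(log n)\<close> steps.

  The balanced supersaturation required by the container step has an explicit solution. If \<open>c(S)\<close> is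
  the sum of \<open>f(u) = deg(u)^(1-s)\<close> over the common neighbours \<open>u\<close> of high degree of an \<open>s\<close>-set
  \<open>S\<close>, give the copy of $K_{s,t}$ with sides \<open>S, T\<close> the weight \<open>(\<Prod>u\<in>T. f(u)) / c(S)^(t-1)\<close>, and
  discard the sets \<open>S\<close> with small \<open>c(S)\<close>. The factor \<open>f(u)\<close> makes the \<open>s\<close>-sets in the
  neighbourhood of \<open>u\<close> carry a total weight proportional to \<open>deg(u)\<close>, however irregular the graph is.
\<close>

section \<open>Containers for weighted hypergraphs\<close>

text \<open>A fingerprint has about \<open>\<tau> |A|\<close> elements, and the sub-bicliques with
  sides \<open>a\<close>, \<open>b\<close> force
  \<open>\<tau>^(ab-1) \<ge> 1/(d^(a-1) \<kappa>^(b-1))\<close>, where \<open>d\<close> is half the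
  average degree and \<open>\<kappa>\<close> an effective number of common neighbours of an
  \<open>s\<close>-set. Plain averaging gives many copies but does not bound the weight through a
  given sub-biclique; the weights are there to do that. Two constraints decide:
  \<open>\<tau> \<ge> 1/\<kappa>\<close> and the one for \<open>(a,b) = (s,t)\<close>. As
  \<open>\<kappa>\<close> is proportional to \<open>|A|^s\<close> with \<open>s \<ge> 2\<close>, the
  first cost, \<open>|A|/\<kappa>\<close> times a logarithm, decays in \<open>|A|\<close> like a
  power; this is the source of the geometric series, and \<open>K\<close> is the size at which
  \<open>p \<kappa> = 2t\<close>. The second constraint gives fingerprints whose size depends on
  neither \<open>|A|\<close> nor \<open>p\<close>; the logarithm paid per element and the number of
  steps together give (log n)^2. The threshold for \<open>p\<close> is the point where the two
  contributions agree. Below it the bound is proved with the threshold in place of \<open>p\<close>,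
  which is legitimate because the union bound only needs an upper bound on \<open>p\<close>.\<close>

definition wdeg :: "'a set \<Rightarrow> ('a set \<Rightarrow> real) \<Rightarrow> 'a set \<Rightarrow> real" where
  "wdeg V w X = (\<Sum>e | e \<subseteq> V \<and> X \<subseteq> e. w e)"

definition uniform_weight :: "'a set \<Rightarrow> nat \<Rightarrow> ('a set \<Rightarrow> real) \<Rightarrow> bool" where
  "uniform_weight V l w \<longleftrightarrow> (\<forall>e. 0 \<le> w e) \<and> (\<forall>e. w e \<noteq> 0 \<longrightarrow> e \<subseteq> V \<and> card e = l)"

definition w_independent :: "('a set \<Rightarrow> real) \<Rightarrow> 'a set \<Rightarrow> bool" where
  "w_independent w I \<longleftrightarrow> (\<forall>e. w e \<noteq> 0 \<longrightarrow> \<not> e \<subseteq> I)"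

text \<open>The threshold is the degree bound that a single link inherits,
  \<open>wdeg V w (insert v X) \<le> D * \<tau> ^ card X\<close>.\<close>

definition saturated :: "'a set \<Rightarrow> real \<Rightarrow> real \<Rightarrow> ('a set \<Rightarrow> real) \<Rightarrow> 'a set \<Rightarrow> bool" where
  "saturated V D \<tau> w X \<longleftrightarrow> X \<noteq> {} \<and> D * \<tau> ^ card X \<le> wdeg V w X"

definition add_link :: "'a \<Rightarrow> ('a set \<Rightarrow> real) \<Rightarrow> ('a set \<Rightarrow> real) \<Rightarrow> 'a set \<Rightarrow> real" where
  "add_link v w w' e = w' e + (if v \<in> e then 0 else w (insert v e))"

text \<open>Edges through \<open>v\<close> go because their weight has moved to the link; edges
  containing a saturated set go so that later links add nothing to its degree.\<close>

definition prune :: "'a set \<Rightarrow> real \<Rightarrow> real \<Rightarrow> 'a \<Rightarrow> ('a set \<Rightarrow> real) \<Rightarrow> ('a set \<Rightarrow> real) \<Rightarrow> 'a set \<Rightarrow> real" where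
  "prune V D \<tau> v w w' e = (if v \<in> e \<or> (\<exists>X\<subseteq>e. saturated V D \<tau> w' X) then 0 else w e)"

definition link_step :: "'a set \<Rightarrow> real \<Rightarrow> real \<Rightarrow> 'a \<Rightarrow> ('a set \<Rightarrow> real) \<times> ('a set \<Rightarrow> real)
    \<Rightarrow> ('a set \<Rightarrow> real) \<times> ('a set \<Rightarrow> real)" where
  "link_step V D \<tau> v st = (prune V D \<tau> v (fst st) (add_link v (fst st) (snd st)),
                          add_link v (fst st) (snd st))"

lemma wdeg_mono:
  assumes "finite V" "\<And>e. e \<subseteq> V \<Longrightarrow> w e \<le> w' e"
  shows "wdeg V w X \<le> wdeg V w' X"
  unfolding wdeg_def using assms by (intro sum_mono) auto

lemma wdeg_nonneg:
  assumes "\<And>e. 0 \<le> w e" shows "0 \<le> wdeg V w X"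
  unfolding wdeg_def using assms by (intro sum_nonneg) auto

lemma wdeg_add_link:
  assumes V: "finite V" "v \<in> V"
  shows "wdeg V (add_link v w w') X = wdeg V w' X + (if v \<in> X then 0 else wdeg V w (insert v X))"
proof -
  have fin: "finite {e. e \<subseteq> V \<and> X \<subseteq> e}" using V by simp
  have "(\<Sum>e | e \<subseteq> V \<and> X \<subseteq> e. if v \<in> e then 0 else w (insert v e))
      = (if v \<in> X then 0 else wdeg V w (insert v X))"
  proof (cases "v \<in> X")
    case True
    then show ?thesis by (auto intro!: sum.neutral)
  next
    case False
    have "(\<Sum>e | e \<subseteq> V \<and> X \<subseteq> e. if v \<in> e then 0 else w (insert v e))
        = (\<Sum>e | e \<subseteq> V \<and> X \<subseteq> e \<and> v \<notin> e. w (insert v e))"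
      using fin by (intro sum.mono_neutral_cong_right) auto
    also have "\<dots> = (\<Sum>e | e \<subseteq> V \<and> insert v X \<subseteq> e. w e)"
      by (rule sum.reindex_bij_witness[of _ "\<lambda>e. e - {v}" "insert v"])
        (use V False in \<open>auto simp: insert_absorb\<close>)
    finally show ?thesis using False by (simp add: wdeg_def)
  qed
  then show ?thesis by (simp add: wdeg_def add_link_def sum.distrib)
qed

text \<open>Each edge is counted once for each of its \<open>2 ^ l\<close> subsets. This controls
  the degrees of all saturated sets at once.\<close>

lemma sum_wdeg_Pow:
  assumes V: "finite V" and w: "uniform_weight V l w"
  shows "(\<Sum>X\<in>Pow V. wdeg V w X) = 2 ^ l * wdeg V w {}"
proof -
  have "(\<Sum>X\<in>Pow V. wdeg V w X) = (\<Sum>X\<in>Pow V. \<Sum>e\<in>{e\<in>Pow V. X \<subseteq> e}. w e)"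
    by (simp add: wdeg_def Pow_def)
  also have "\<dots> = (\<Sum>e\<in>Pow V. \<Sum>X\<in>{X\<in>Pow V. X \<subseteq> e}. w e)"
    using V by (intro sum.swap_restrict) auto
  also have "\<dots> = (\<Sum>e\<in>Pow V. 2 ^ l * w e)"
  proof (rule sum.cong)
    fix e assume e: "e \<in> Pow V"
    then have "{X\<in>Pow V. X \<subseteq> e} = Pow e" "finite e" using V by (auto intro: finite_subset)
    then have "(\<Sum>X\<in>{X\<in>Pow V. X \<subseteq> e}. w e) = 2 ^ card e * w e" by (simp add: card_Pow)
    then show "(\<Sum>X\<in>{X\<in>Pow V. X \<subseteq> e}. w e) = 2 ^ l * w e"
      using w by (cases "w e = 0") (auto simp: uniform_weight_def)
  qed simp
  finally show ?thesis by (simp add: wdeg_def Pow_def sum_distrib_left)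
qed

lemma sum_wdeg_singleton:
  assumes V: "finite V" and w: "uniform_weight V l w"
  shows "(\<Sum>v\<in>V. wdeg V w {v}) = real l * wdeg V w {}"
proof -
  have "(\<Sum>v\<in>V. wdeg V w {v}) = (\<Sum>v\<in>V. \<Sum>e\<in>{e\<in>Pow V. v \<in> e}. w e)"
    by (simp add: wdeg_def Pow_def)
  also have "\<dots> = (\<Sum>e\<in>Pow V. \<Sum>v\<in>{v\<in>V. v \<in> e}. w e)"
    using V by (intro sum.swap_restrict) auto
  also have "\<dots> = (\<Sum>e\<in>Pow V. real l * w e)"
  proof (rule sum.cong)
    fix e assume e: "e \<in> Pow V"
    then have "{v\<in>V. v \<in> e} = e" by auto
    then show "(\<Sum>v\<in>{v\<in>V. v \<in> e}. w e) = real l * w e"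
      using w by (cases "w e = 0") (auto simp: uniform_weight_def)
  qed simp
  finally show ?thesis by (simp add: wdeg_def Pow_def sum_distrib_left)
qed

text \<open>In one round vertices of an independent set are selected greedily by degree: \<open>w0\<close> is the
  initial weight, \<open>w\<close> what is left of it, and \<open>w'\<close> collects the links of the selected vertices. If
  \<open>w'\<close> ends up large, it is the input of the next round, with uniformity reduced by one; otherwise all
  vertices of the independent set have small degree in \<open>w\<close>, and the vertices of small degree
  form the container. The last inequality says that weight leaves
  \<open>w\<close> only by moving to \<open>w'\<close> or by being charged to a saturated set.\<close>

definition round_inv where
  "round_inv V l D \<tau> w0 w w' \<longleftrightarrow>
     (\<forall>e. w e = 0 \<or> w e = w0 e) \<and> uniform_weight V l w' \<and>
     (\<forall>X. X \<noteq> {} \<longrightarrow> wdeg V w' X \<le> 2 * D * \<tau> ^ card X) \<and>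
     (\<forall>X e. saturated V D \<tau> w' X \<longrightarrow> X \<subseteq> e \<longrightarrow> w e = 0) \<and>
     wdeg V w0 {} \<le> wdeg V w {} + wdeg V w' {} + (\<Sum>X | X \<subseteq> V \<and> saturated V D \<tau> w' X. wdeg V w0 X)"

lemma round_inv_init:
  assumes "D > 0" "\<tau> > 0"
  shows "round_inv V l D \<tau> w0 w0 (\<lambda>_. 0)"
proof -
  have "\<not> saturated V D \<tau> (\<lambda>_. 0) X" for X
    using assms by (simp add: saturated_def wdeg_def not_le)
  moreover have "wdeg V (\<lambda>_. 0) X = 0" for X by (simp add: wdeg_def)
  ultimately show ?thesis using assms by (simp add: round_inv_def uniform_weight_def)
qed

text \<open>An unsaturated \<open>X\<close> has degree below \<open>D * \<tau> ^ card X\<close>, one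
  link adds at most \<open>D * \<tau> ^ card X\<close>, and after saturation nothing is added. Hence
  the factor 2 in the invariant.\<close>

lemma round_inv_step:
  assumes V: "finite V" "v \<in> V" and D: "D > 0" "\<tau> > 0" and w0: "uniform_weight V (Suc l) w0"
    and deg: "\<And>X. X \<noteq> {} \<Longrightarrow> wdeg V w0 X \<le> D * \<tau> ^ (card X - 1)"
    and inv: "round_inv V l D \<tau> w0 w w'"
  defines "w1' \<equiv> add_link v w w'"
  defines "w1 \<equiv> prune V D \<tau> v w w1'"
  shows "round_inv V l D \<tau> w0 w1 w1'"
proof -
  note inv' = inv[unfolded round_inv_def]
  have w0_nonneg: "0 \<le> w0 e" for e using w0 by (auto simp: uniform_weight_def)
  have w_nonneg: "0 \<le> w e" for e
    using inv' w0_nonneg[of e] by (metis order_refl)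
  have w_le: "w e \<le> w0 e" for e using inv' w0_nonneg[of e] by (metis order_refl)
  have w'_le: "w' e \<le> w1' e" for e unfolding w1'_def add_link_def using w_nonneg by simp
  have sat_mono: "saturated V D \<tau> w1' X" if "saturated V D \<tau> w' X" for X
    using that wdeg_mono[of V w' w1' X] V w'_le by (auto simp: saturated_def)
  have deg_w1': "wdeg V w1' X = wdeg V w' X + (if v \<in> X then 0 else wdeg V w (insert v X))" for X
    unfolding w1'_def using V by (rule wdeg_add_link)
  have A1: "\<forall>e. w1 e = 0 \<or> w1 e = w0 e" using inv' unfolding w1_def prune_def by auto
  have A2: "uniform_weight V l w1'"
    unfolding uniform_weight_def
  proof (intro conjI allI impI)
    fix e show "0 \<le> w1' e" using inv' w'_le[of e] by (auto simp: uniform_weight_def intro: order_trans)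
    assume "w1' e \<noteq> 0"
    then consider "w' e \<noteq> 0" | "v \<notin> e" "w (insert v e) \<noteq> 0"
      unfolding w1'_def add_link_def by (cases "w' e = 0"; cases "v \<in> e") auto
    then have "e \<subseteq> V \<and> card e = l"
    proof cases
      case 1 then show ?thesis using inv' by (auto simp: uniform_weight_def)
    next
      case 2
      then have "insert v e \<subseteq> V \<and> card (insert v e) = Suc l"
        using inv' w0 by (metis uniform_weight_def)
      moreover from this have "finite e" using V by (auto intro: finite_subset)
      ultimately show ?thesis using 2 by simp
    qed
    then show "e \<subseteq> V" "card e = l" by auto
  qed
  have A3: "\<forall>X. X \<noteq> {} \<longrightarrow> wdeg V w1' X \<le> 2 * D * \<tau> ^ card X"
  proof (intro allI impI)
    fix X :: "'a set" assume X: "X \<noteq> {}"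
    show "wdeg V w1' X \<le> 2 * D * \<tau> ^ card X"
    proof (cases "v \<in> X \<or> saturated V D \<tau> w' X \<or> \<not> X \<subseteq> V")
      case True
      \<comment> \<open>If \<open>X\<close> was saturated before, every edge containing
        \<open>insert v X\<close> has already lost its weight; in the other two cases there is
        nothing to add.\<close>
      have "(if v \<in> X then 0 else wdeg V w (insert v X)) = 0"
      proof (cases "v \<in> X \<or> \<not> X \<subseteq> V")
        case True
        then show ?thesis by (auto simp: wdeg_def intro!: sum.neutral)
      next
        case False
        then have "saturated V D \<tau> w' X" using True by auto
        then show ?thesis using inv' unfolding wdeg_def
          by (auto intro!: sum.neutral)
      qed
      then show ?thesis using inv' X deg_w1'[of X] by auto
    next
      case False
      then have "wdeg V w' X < D * \<tau> ^ card X" using X by (auto simp: saturated_def)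
      moreover have "wdeg V w (insert v X) \<le> D * \<tau> ^ card X"
      proof -
        have "finite X" using False V by (auto intro: finite_subset)
        then show ?thesis
          using wdeg_mono[of V w w0 "insert v X"] deg[of "insert v X"] False V w_le by auto
      qed
      ultimately show ?thesis using False deg_w1'[of X] by simp
    qed
  qed
  have A4: "\<forall>X e. saturated V D \<tau> w1' X \<longrightarrow> X \<subseteq> e \<longrightarrow> w1 e = 0"
    unfolding w1_def prune_def by auto
  have A5: "wdeg V w0 {} \<le> wdeg V w1 {} + wdeg V w1' {}
      + (\<Sum>X | X \<subseteq> V \<and> saturated V D \<tau> w1' X. wdeg V w0 X)"
  proof -
    let ?S = "{X. X \<subseteq> V \<and> saturated V D \<tau> w' X}" and ?S1 = "{X. X \<subseteq> V \<and> saturated V D \<tau> w1' X}"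
    have sub: "?S \<subseteq> ?S1" using sat_mono by auto
    have finS: "finite ?S1" using V by auto
    \<comment> \<open>An edge that loses its weight contains \<open>v\<close> or a set that became
      saturated in this very step: with an older saturated subset its weight would be zero
      already.\<close>
    have ptw: "w e \<le> w1 e + (if v \<in> e then w e else 0) + (\<Sum>X\<in>?S1 - ?S. if X \<subseteq> e then w e else 0)"
      if e: "e \<subseteq> V" for e
    proof (cases "w1 e = w e \<or> v \<in> e")
      case True
      have "0 \<le> (\<Sum>X\<in>?S1 - ?S. if X \<subseteq> e then w e else 0)" using w_nonneg by (intro sum_nonneg) auto
      moreover have "0 \<le> w1 e" using w_nonneg by (auto simp: w1_def prune_def)
      ultimately show ?thesis using True w_nonneg[of e] by auto
    next
      case False
      then obtain X where X: "X \<subseteq> e" "saturated V D \<tau> w1' X" "w e \<noteq> 0"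
        unfolding w1_def prune_def by (auto split: if_splits)
      then have "X \<in> ?S1 - ?S" using e inv' by auto
      then have "(if X \<subseteq> e then w e else 0) \<le> (\<Sum>X\<in>?S1 - ?S. if X \<subseteq> e then w e else 0)"
        using finS w_nonneg by (intro member_le_sum) auto
      moreover have "0 \<le> w1 e" using w_nonneg by (auto simp: w1_def prune_def)
      ultimately show ?thesis using X False by auto
    qed
    have "wdeg V w {} \<le> (\<Sum>e | e \<subseteq> V. w1 e + (if v \<in> e then w e else 0)
        + (\<Sum>X\<in>?S1 - ?S. if X \<subseteq> e then w e else 0))"
      unfolding wdeg_def using ptw by (auto intro!: sum_mono)
    also have "\<dots> = wdeg V w1 {} + (\<Sum>e | e \<subseteq> V. if v \<in> e then w e else 0)
        + (\<Sum>e | e \<subseteq> V. \<Sum>X\<in>?S1 - ?S. if X \<subseteq> e then w e else 0)"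
      by (simp add: sum.distrib wdeg_def)
    also have "(\<Sum>e | e \<subseteq> V. if v \<in> e then w e else 0) = wdeg V w {v}"
      unfolding wdeg_def using V by (intro sum.mono_neutral_cong_right) auto
    also have "(\<Sum>e | e \<subseteq> V. \<Sum>X\<in>?S1 - ?S. if X \<subseteq> e then w e else 0)
        = (\<Sum>X\<in>?S1 - ?S. wdeg V w X)"
      unfolding wdeg_def using V
      by (subst sum.swap) (intro sum.cong sum.mono_neutral_cong_right, auto)
    also have "(\<Sum>X\<in>?S1 - ?S. wdeg V w X) \<le> (\<Sum>X\<in>?S1 - ?S. wdeg V w0 X)"
      using V w_le by (intro sum_mono wdeg_mono) auto
    finally have "wdeg V w {} \<le> wdeg V w1 {} + wdeg V w {v} + (\<Sum>X\<in>?S1 - ?S. wdeg V w0 X)" by simp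
    moreover have "(\<Sum>X\<in>?S1. wdeg V w0 X) = (\<Sum>X\<in>?S1 - ?S. wdeg V w0 X) + (\<Sum>X\<in>?S. wdeg V w0 X)"
      using sum.subset_diff[OF sub finS] by simp
    ultimately show ?thesis using inv' deg_w1'[of "{}"] by simp
  qed
  show ?thesis unfolding round_inv_def using A1 A2 A3 A4 A5 by blast
qed

text \<open>For saturated \<open>X\<close>, \<open>wdeg V w0 X \<le> D * \<tau> ^ (card X - 1) \<le>
  wdeg V w' X / \<tau>\<close>, so everything charged to saturated sets is paid for by the degrees
  in \<open>w'\<close>.\<close>

lemma round_inv_total:
  assumes V: "finite V" and D: "\<tau> > 0"
    and deg: "\<And>X. X \<noteq> {} \<Longrightarrow> wdeg V w0 X \<le> D * \<tau> ^ (card X - 1)"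
    and inv: "round_inv V l D \<tau> w0 w w'"
  shows "wdeg V w0 {} \<le> wdeg V w {} + (1 + 2 ^ l / \<tau>) * wdeg V w' {}"
proof -
  note inv' = inv[unfolded round_inv_def]
  have w': "uniform_weight V l w'" using inv' by auto
  have "(\<Sum>X | X \<subseteq> V \<and> saturated V D \<tau> w' X. wdeg V w0 X)
      \<le> (\<Sum>X | X \<subseteq> V \<and> saturated V D \<tau> w' X. wdeg V w' X / \<tau>)"
  proof (rule sum_mono)
    fix X assume X: "X \<in> {X. X \<subseteq> V \<and> saturated V D \<tau> w' X}"
    then have "X \<noteq> {}" "finite X" using V by (auto simp: saturated_def intro: finite_subset)
    then obtain j where "card X = Suc j" by (metis card_0_eq not0_implies_Suc)
    then show "wdeg V w0 X \<le> wdeg V w' X / \<tau>"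
      using X deg[OF \<open>X \<noteq> {}\<close>] D by (auto simp: saturated_def field_simps) (smt (verit) mult_left_mono mult.commute mult.left_commute)
  qed
  also have "\<dots> \<le> (\<Sum>X\<in>Pow V. wdeg V w' X / \<tau>)"
    using V D w' by (intro sum_mono2) (auto simp: uniform_weight_def intro!: divide_nonneg_pos wdeg_nonneg)
  also have "\<dots> = 2 ^ l / \<tau> * wdeg V w' {}"
    using sum_wdeg_Pow[OF V w'] by (simp add: sum_divide_distrib[symmetric])
  finally show ?thesis using inv' by (simp add: algebra_simps)
qed

section \<open>Greedy selection and fingerprints\<close>

primrec run :: "('s \<Rightarrow> 'a set \<Rightarrow> 'a) \<Rightarrow> ('a \<Rightarrow> 's \<Rightarrow> 's) \<Rightarrow> 's \<Rightarrow> nat \<Rightarrow> 'a set \<Rightarrow> 's" where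
  "run sel upd s0 0 I = s0"
| "run sel upd s0 (Suc i) I = upd (sel (run sel upd s0 i I) I) (run sel upd s0 i I)"

text \<open>A run depends only on the elements it selects, because the selection rule ranks all
  candidates.\<close>

lemma run_fingerprint:
  assumes sel: "\<And>s I J. J \<noteq> {} \<Longrightarrow> J \<subseteq> I \<Longrightarrow> I \<subseteq> V \<Longrightarrow> sel s I \<in> J \<Longrightarrow> sel s J = sel s I"
    and I: "I \<subseteq> V" "J \<subseteq> I" and J: "(\<lambda>i. sel (run sel upd s0 i I) I) ` {..<b} \<subseteq> J"
  shows "i \<le> b \<Longrightarrow> run sel upd s0 i J = run sel upd s0 i I"
proof (induction i)
  case (Suc i)
  then have "sel (run sel upd s0 i I) I \<in> J" using J by auto
  then have "sel (run sel upd s0 i I) J = sel (run sel upd s0 i I) I"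
    using sel[of J I] I by blast
  then show ?case using Suc by simp
qed simp

text \<open>Ties are broken by a fixed numbering \<open>h\<close>. Otherwise \<open>J\<close> might
  pick another maximiser than \<open>I\<close>, and the last property, on which the reconstruction
  of a run from its fingerprint rests, could fail.\<close>

lemma max_selection:
  fixes V :: "'a set" and key :: "'s \<Rightarrow> 'a \<Rightarrow> real"
  assumes "finite V"
  obtains sel :: "'s \<Rightarrow> 'a set \<Rightarrow> 'a" where
    "\<And>s I. I \<subseteq> V \<Longrightarrow> I \<noteq> {} \<Longrightarrow> sel s I \<in> I"
    "\<And>s I v. I \<subseteq> V \<Longrightarrow> v \<in> I \<Longrightarrow> key s v \<le> key s (sel s I)"
    "\<And>s I J. J \<noteq> {} \<Longrightarrow> J \<subseteq> I \<Longrightarrow> I \<subseteq> V \<Longrightarrow> sel s I \<in> J \<Longrightarrow> sel s J = sel s I"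
proof -
  obtain h :: "'a \<Rightarrow> nat" where h: "inj_on h V"
    using finite_imp_inj_to_nat_seg[OF assms] by blast
  define best where "best s I v \<longleftrightarrow> v \<in> I \<and> (\<forall>u\<in>I. key s u \<le> key s v)" for s I v
  define sel where "sel s I = (ARG_MIN h v. best s I v)" for s I
  have best_ex: "\<exists>v. best s I v" if "I \<subseteq> V" "I \<noteq> {}" for s I
  proof -
    have "finite (key s ` I)" "key s ` I \<noteq> {}" using that assms by (auto intro: finite_subset)
    then have "Max (key s ` I) \<in> key s ` I" "\<forall>x\<in>key s ` I. x \<le> Max (key s ` I)" by auto
    then obtain v where "v \<in> I" "key s v = Max (key s ` I)" by fastforce
    moreover have "key s u \<le> Max (key s ` I)" if "u \<in> I" for u
      using that \<open>\<forall>x\<in>key s ` I. x \<le> Max (key s ` I)\<close> by blast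
    ultimately show ?thesis unfolding best_def by (intro exI[of _ v]) auto
  qed
  have sel: "best s I (sel s I)" "best s I v \<Longrightarrow> h (sel s I) \<le> h v" if I: "I \<subseteq> V" "I \<noteq> {}" for s I v
  proof -
    obtain x where "best s I x" using best_ex[OF I] by blast
    from arg_min_nat_lemma[of "best s I", OF this, of h]
    show "best s I (sel s I)" "best s I v \<Longrightarrow> h (sel s I) \<le> h v" unfolding sel_def by blast+
  qed
  show ?thesis
  proof (rule that[of sel])
    show "sel s I \<in> I" if "I \<subseteq> V" "I \<noteq> {}" for s I using sel(1)[OF that] by (auto simp: best_def)
    show "key s v \<le> key s (sel s I)" if "I \<subseteq> V" "v \<in> I" for s I v
      using sel(1)[of I s] that by (auto simp: best_def)
    show "sel s J = sel s I" if J: "J \<noteq> {}" "J \<subseteq> I" "I \<subseteq> V" "sel s I \<in> J" for s I J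
    proof -
      have I: "I \<noteq> {}" and JV: "J \<subseteq> V" using J by auto
      have 1: "best s J (sel s I)" using sel(1)[OF J(3) I, of s] J by (auto simp: best_def)
      have "key s (sel s I) \<le> key s (sel s J)" using sel(1)[OF JV J(1), of s] J(4) by (auto simp: best_def)
      then have 2: "best s I (sel s J)"
        using sel(1)[OF J(3) I, of s] sel(1)[OF JV J(1), of s] J(2)
        unfolding best_def by (meson order_trans subsetD)
      have "h (sel s J) = h (sel s I)"
        using sel(2)[OF J(3) I 2] sel(2)[OF JV J(1) 1] by simp
      then show ?thesis using h 1 2 J unfolding best_def inj_on_def by blast
    qed
  qed
qed

text \<open>Selected vertices have maximal degree within \<open>I\<close> and degrees in
  \<open>w\<close> never grow, so \<open>b\<close> selections collect at least \<open>b\<close>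
  times the degree that any \<open>v \<in> I\<close> has in the end. The run always makes
  \<open>b\<close> selections; a repeated vertex has an empty link by then, hence only
  \<open>card T \<le> b\<close>.\<close>

lemma round_exists:
  fixes V :: "'a set"
  assumes V: "finite V" and D: "D > 0" "\<tau> > 0" and w0: "uniform_weight V (Suc l) w0"
    and deg: "\<And>X. X \<noteq> {} \<Longrightarrow> wdeg V w0 X \<le> D * \<tau> ^ (card X - 1)"
  obtains P :: "'a set \<Rightarrow> ('a set \<Rightarrow> real) \<times> ('a set \<Rightarrow> real)" where
    "\<And>I. I \<subseteq> V \<Longrightarrow> I \<noteq> {} \<Longrightarrow> \<exists>T\<subseteq>I. card T \<le> b \<and> (\<forall>J. T \<subseteq> J \<longrightarrow> J \<subseteq> I \<longrightarrow> P J = P I)"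
    "\<And>I. I \<subseteq> V \<Longrightarrow> I \<noteq> {} \<Longrightarrow> round_inv V l D \<tau> w0 (fst (P I)) (snd (P I))"
    "\<And>I v. I \<subseteq> V \<Longrightarrow> v \<in> I \<Longrightarrow> real b * wdeg V (fst (P I)) {v} \<le> wdeg V (snd (P I)) {}"
    "\<And>I. I \<subseteq> V \<Longrightarrow> I \<noteq> {} \<Longrightarrow> w_independent w0 I \<Longrightarrow> w_independent (snd (P I)) I"
proof -
  define key where "key s v = wdeg V (fst s) {v}" for s :: "('a set \<Rightarrow> real) \<times> ('a set \<Rightarrow> real)" and v
  obtain sel where sel: "\<And>s I. I \<subseteq> V \<Longrightarrow> I \<noteq> {} \<Longrightarrow> sel s I \<in> I"
    "\<And>s I v. I \<subseteq> V \<Longrightarrow> v \<in> I \<Longrightarrow> key s v \<le> key s (sel s I)"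
    "\<And>s I J. J \<noteq> {} \<Longrightarrow> J \<subseteq> I \<Longrightarrow> I \<subseteq> V \<Longrightarrow> sel s I \<in> J \<Longrightarrow> sel s J = sel s I"
    using max_selection[OF V, of key] by metis
  define R where "R = run sel (link_step V D \<tau>) (w0, \<lambda>_. 0)"
  have R0: "R 0 I = (w0, \<lambda>_. 0)" for I by (simp add: R_def)
  have RS: "R (Suc i) I = link_step V D \<tau> (sel (R i I) I) (R i I)" for i I by (simp add: R_def)
  have w0_nonneg: "0 \<le> w0 e" for e using w0 by (auto simp: uniform_weight_def)
  have inv: "round_inv V l D \<tau> w0 (fst (R i I)) (snd (R i I))" if I: "I \<subseteq> V" "I \<noteq> {}" for i I
  proof (induction i)
    case 0 then show ?case using round_inv_init[OF D] by (simp add: R0)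
  next
    case (Suc i)
    have "sel (R i I) I \<in> V" using sel(1)[OF I, of "R i I"] I by blast
    from round_inv_step[OF V this D w0 deg Suc] show ?case by (simp add: RS link_step_def)
  qed
  have nonneg: "0 \<le> fst (R i I) e" if I: "I \<subseteq> V" "I \<noteq> {}" for i I e
    using inv[OF I, of i] w0_nonneg[of e] unfolding round_inv_def by (metis order_refl)
  have avg: "real i * wdeg V (fst (R i I)) {v} \<le> wdeg V (snd (R i I)) {}" if I: "I \<subseteq> V" "v \<in> I" for i I v
  proof (induction i)
    case 0 then show ?case by (simp add: R0 wdeg_def)
  next
    case (Suc i)
    let ?u = "sel (R i I) I"
    have ne: "I \<noteq> {}" using I by auto
    have u: "?u \<in> V" using sel(1)[OF I(1) ne, of "R i I"] I by blast
    have "wdeg V (fst (R (Suc i) I)) {v} \<le> wdeg V (fst (R i I)) {v}"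
      using nonneg[OF I(1) ne] V by (intro wdeg_mono) (auto simp: RS link_step_def prune_def)
    moreover have "wdeg V (fst (R i I)) {v} \<le> wdeg V (fst (R i I)) {?u}"
      using sel(2)[OF I] by (simp add: key_def)
    moreover have "wdeg V (snd (R (Suc i) I)) {} = wdeg V (snd (R i I)) {} + wdeg V (fst (R i I)) {?u}"
      using wdeg_add_link[OF V u] by (simp add: RS link_step_def)
    moreover have "real i * wdeg V (fst (R (Suc i) I)) {v} \<le> real i * wdeg V (fst (R i I)) {v}"
      using calculation(1) by (intro mult_left_mono) auto
    ultimately show ?case using Suc by (simp add: distrib_right)
  qed
  have indep: "w_independent (snd (R i I)) I" if I: "I \<subseteq> V" "I \<noteq> {}" "w_independent w0 I" for i I
  proof (induction i)
    case 0 then show ?case by (simp add: R0 w_independent_def)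
  next
    case (Suc i)
    let ?u = "sel (R i I) I"
    have u: "?u \<in> I" using sel(1)[OF I(1,2)] .
    show ?case unfolding w_independent_def
    proof (intro allI impI)
      fix e assume "snd (R (Suc i) I) e \<noteq> 0"
      then consider "snd (R i I) e \<noteq> 0" | "fst (R i I) (insert ?u e) \<noteq> 0"
        by (cases "snd (R i I) e = 0"; cases "?u \<in> e") (auto simp: RS link_step_def add_link_def)
      then show "\<not> e \<subseteq> I"
      proof cases
        case 1 then show ?thesis using Suc by (auto simp: w_independent_def)
      next
        case 2
        then have "w0 (insert ?u e) \<noteq> 0" using inv[OF I(1,2), of i] by (metis round_inv_def)
        then show ?thesis using I(3) u by (auto simp: w_independent_def)
      qed
    qed
  qed
  show ?thesis
  proof (rule that[of "R b"])
    fix I assume I: "I \<subseteq> V" "I \<noteq> {}"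
    let ?T = "(\<lambda>i. sel (R i I) I) ` {..<b}"
    have "?T \<subseteq> I" using sel(1)[OF I] by blast
    moreover have "card ?T \<le> b" using card_image_le[of "{..<b}"] by fastforce
    moreover have "R b J = R b I" if "?T \<subseteq> J" "J \<subseteq> I" for J
      unfolding R_def using sel(3) I(1) that(2)
      by (rule run_fingerprint[where b = b]) (use that(1) in \<open>auto simp: R_def\<close>)
    ultimately show "\<exists>T\<subseteq>I. card T \<le> b \<and> (\<forall>J. T \<subseteq> J \<longrightarrow> J \<subseteq> I \<longrightarrow> R b J = R b I)" by blast
  qed (use inv avg indep in auto)
qed

section \<open>The container theorem\<close>

lemma card_low_degree_le:
  fixes D \<eta> \<epsilon> :: real
  assumes V: "finite V" and w: "uniform_weight V l w" and l: "l \<ge> 1"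
    and deg: "\<And>v. wdeg V w {v} \<le> D" and D: "D > 0" and \<eta>: "\<eta> \<ge> 0"
    and tot: "wdeg V w {} \<ge> \<epsilon> * card V * D"
  shows "card {v \<in> V. wdeg V w {v} \<le> \<eta> * D} \<le> (1 - (\<epsilon> - \<eta>)) * card V"
proof -
  let ?C = "{v \<in> V. wdeg V w {v} \<le> \<eta> * D}"
  have wn: "0 \<le> wdeg V w X" for X using w by (auto simp: uniform_weight_def intro: wdeg_nonneg)
  have "\<epsilon> * card V * D \<le> real l * wdeg V w {}"
    using tot l wn[of "{}"] mult_right_mono[of 1 "real l" "wdeg V w {}"] by simp
  also have "\<dots> = (\<Sum>v\<in>V. wdeg V w {v})" using sum_wdeg_singleton[OF V w] by simp
  also have "\<dots> = (\<Sum>v\<in>V - ?C. wdeg V w {v}) + (\<Sum>v\<in>?C. wdeg V w {v})"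
    using V by (intro sum.subset_diff) auto
  also have "\<dots> \<le> card (V - ?C) * D + card ?C * (\<eta> * D)"
    using deg by (intro add_mono sum_bounded_above) auto
  also have "\<dots> \<le> card (V - ?C) * D + card V * (\<eta> * D)"
    using V D \<eta> by (auto intro!: mult_right_mono card_mono)
  also have "real (card (V - ?C)) = real (card V) - real (card ?C)"
    using V by (simp add: card_Diff_subset card_mono of_nat_diff)
  finally have "(\<epsilon> * card V) * D \<le> (real (card V) - real (card ?C) + real (card V) * \<eta>) * D" by (simp add: algebra_simps)
  then have "\<epsilon> * card V \<le> real (card V) - real (card ?C) + real (card V) * \<eta>"
    using D by (rule mult_right_le_imp_le)
  then show ?thesis by (simp add: algebra_simps)
qed

text \<open>The map is required to be constant on the whole interval from \<open>T\<close> to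
  \<open>I\<close> so that fingerprints of successive rounds can be united: at
  \<open>T \<union> T'\<close> both rounds behave as on \<open>I\<close>. The empty set is excluded
  because nothing can be selected from it.\<close>

definition container_map :: "('a set \<Rightarrow> bool) \<Rightarrow> 'a set \<Rightarrow> real \<Rightarrow> nat \<Rightarrow> ('a set \<Rightarrow> 'a set) \<Rightarrow> bool" where
  "container_map P V c b f \<longleftrightarrow> (\<forall>I\<subseteq>V. I \<noteq> {} \<longrightarrow> P I \<longrightarrow>
     I \<subseteq> f I \<and> f I \<subseteq> V \<and> real (card (f I)) \<le> c \<and>
     (\<exists>T\<subseteq>I. card T \<le> b \<and> (\<forall>J. T \<subseteq> J \<longrightarrow> J \<subseteq> I \<longrightarrow> f J = f I)))"

lemma container_map_mono:
  assumes f: "container_map P V c b f" and P: "\<And>I. Q I \<Longrightarrow> P I" and le: "c \<le> c'" "b \<le> b'"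
  shows "container_map Q V c' b' f"
  unfolding container_map_def
proof (intro allI impI)
  fix I assume I: "I \<subseteq> V" "I \<noteq> {}" "Q I"
  from f[unfolded container_map_def, rule_format, OF I(1,2) P[OF I(3)]] le
  show "I \<subseteq> f I \<and> f I \<subseteq> V \<and> real (card (f I)) \<le> c' \<and>
     (\<exists>T\<subseteq>I. card T \<le> b' \<and> (\<forall>J. T \<subseteq> J \<longrightarrow> J \<subseteq> I \<longrightarrow> f J = f I))"
    by (meson order_trans)
qed

text \<open>\<open>\<delta>\<close> is fixed before the hypergraph since every later application
  brings a new edge set with a new weight. The hypothesis \<open>\<tau> * card V \<le> b\<close>
  turns a small total weight of the links into small degrees on \<open>I\<close>.\<close>

theorem weighted_container:
  fixes \<epsilon> :: real
  assumes "\<epsilon> > 0"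
  shows "\<exists>(\<delta>::real)>0. \<forall>(V :: 'a set) w (\<tau> :: real) (D :: real) (b :: nat).
     finite V \<longrightarrow> 0 < \<tau> \<longrightarrow> \<tau> \<le> 1 \<longrightarrow> 0 < D \<longrightarrow> \<tau> * card V \<le> real b \<longrightarrow> b > 0 \<longrightarrow>
     uniform_weight V (Suc l) w \<longrightarrow> (\<forall>X. X \<noteq> {} \<longrightarrow> wdeg V w X \<le> D * \<tau> ^ (card X - 1)) \<longrightarrow>
     \<epsilon> * card V * D \<le> wdeg V w {} \<longrightarrow>
     (\<exists>f. container_map (w_independent w) V ((1 - \<delta>) * real (card V)) (l * b) f)"
  using assms unfolding container_map_def
proof (induction l arbitrary: \<epsilon>)
  case 0
  show ?case
  proof (intro exI[of _ \<epsilon>] conjI allI impI)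
    fix V :: "'a set" and w and \<tau> D :: real and b :: nat
    assume V: "finite V" and D: "0 < D" and w: "uniform_weight V (Suc 0) w"
      and deg: "\<forall>X. X \<noteq> {} \<longrightarrow> wdeg V w X \<le> D * \<tau> ^ (card X - 1)"
      and tot: "\<epsilon> * card V * D \<le> wdeg V w {}"
    \<comment> \<open>Edges are single vertices here, so an independent set contains no vertex of
      positive degree and the empty fingerprint suffices.\<close>
    let ?C = "{v \<in> V. wdeg V w {v} \<le> 0 * D}"
    have "card ?C \<le> (1 - (\<epsilon> - 0)) * card V"
      using deg by (intro card_low_degree_le[OF V w _ _ D _ tot]) (auto dest: spec[of _ "{_}"])
    moreover have "I \<subseteq> ?C" if I: "I \<subseteq> V" "w_independent w I" for I
    proof -
      have "wdeg V w {v} = 0" if "v \<in> I" for v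
        unfolding wdeg_def
      proof (rule sum.neutral, safe)
        fix e assume e: "e \<subseteq> V" "{v} \<subseteq> e"
        show "w e = 0"
        proof (rule ccontr)
          assume "w e \<noteq> 0"
          moreover from this have "card e = 1" using w by (auto simp: uniform_weight_def)
          then have "e = {v}" using e by (auto simp: card_1_singleton_iff)
          ultimately show False using I that by (auto simp: w_independent_def)
        qed
      qed
      then show ?thesis using I by auto
    qed
    ultimately show "\<exists>f. \<forall>I\<subseteq>V. I \<noteq> {} \<longrightarrow> w_independent w I \<longrightarrow>
        I \<subseteq> f I \<and> f I \<subseteq> V \<and> real (card (f I)) \<le> (1 - \<epsilon>) * real (card V) \<and>
        (\<exists>T\<subseteq>I. card T \<le> 0 * b \<and> (\<forall>J. T \<subseteq> J \<longrightarrow> J \<subseteq> I \<longrightarrow> f J = f I))"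
      by (intro exI[of _ "\<lambda>_. ?C"]) (auto intro!: exI[of _ "{}"])
  qed (use 0 in auto)
next
  case (Suc l)
  \<comment> \<open>Small enough that light links cost at most half of the weight,
    \<open>\<epsilon>' * (1 + 2 ^ Suc l) \<le> \<epsilon> / 2\<close>, and that
    \<open>\<epsilon> / 2 - \<epsilon>' \<ge> \<epsilon>'\<close> in the final count of low-degree
    vertices.\<close>
  define \<epsilon>' where "\<epsilon>' = \<epsilon> / 2 ^ (l + 3)"
  have \<epsilon>': "\<epsilon>' > 0" using Suc.prems by (simp add: \<epsilon>'_def)
  have small: "\<epsilon>' * (1 + 2 ^ Suc l) \<le> \<epsilon> / 2" "4 * \<epsilon>' \<le> \<epsilon>"
  proof -
    have "(1::real) \<le> 2 ^ l" by simp
    then have "(1::real) \<le> 2 * 2 ^ l" by linarith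
    then show "\<epsilon>' * (1 + 2 ^ Suc l) \<le> \<epsilon> / 2" "4 * \<epsilon>' \<le> \<epsilon>"
      using Suc.prems by (auto simp: \<epsilon>'_def power_add field_simps)
  qed
  obtain \<delta> :: real where \<delta>: "\<delta> > 0" and IH: "\<And>(V :: 'a set) w (\<tau> :: real) (D :: real) (b :: nat). finite V \<Longrightarrow> 0 < \<tau> \<Longrightarrow> \<tau> \<le> 1 \<Longrightarrow> 0 < D \<Longrightarrow>
     \<tau> * card V \<le> real b \<Longrightarrow> b > 0 \<Longrightarrow> uniform_weight V (Suc l) w \<Longrightarrow>
     (\<forall>X. X \<noteq> {} \<longrightarrow> wdeg V w X \<le> D * \<tau> ^ (card X - 1)) \<Longrightarrow>
     \<epsilon>' / 2 * card V * D \<le> wdeg V w {} \<Longrightarrow>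
     (\<exists>f. \<forall>I\<subseteq>V. I \<noteq> {} \<longrightarrow> w_independent w I \<longrightarrow>
        I \<subseteq> f I \<and> f I \<subseteq> V \<and> real (card (f I)) \<le> (1 - \<delta>) * real (card V) \<and>
        (\<exists>T\<subseteq>I. card T \<le> l * b \<and> (\<forall>J. T \<subseteq> J \<longrightarrow> J \<subseteq> I \<longrightarrow> f J = f I)))"
    using Suc.IH[of "\<epsilon>' / 2"] \<epsilon>' by auto
  show ?case
  proof (intro exI[of _ "min \<delta> \<epsilon>'"] conjI allI impI)
    show "min \<delta> \<epsilon>' > 0" using \<delta> \<epsilon>' by simp
    fix V :: "'a set" and w0 and \<tau> D :: real and b :: nat
    assume V: "finite V" and \<tau>: "0 < \<tau>" "\<tau> \<le> 1" and D: "0 < D" and b: "\<tau> * card V \<le> real b" "b > 0"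
      and w0: "uniform_weight V (Suc (Suc l)) w0"
      and deg: "\<forall>X. X \<noteq> {} \<longrightarrow> wdeg V w0 X \<le> D * \<tau> ^ (card X - 1)"
      and tot: "\<epsilon> * card V * D \<le> wdeg V w0 {}"
    obtain P where
      P1: "\<And>I. I \<subseteq> V \<Longrightarrow> I \<noteq> {} \<Longrightarrow> \<exists>T\<subseteq>I. card T \<le> b \<and> (\<forall>J. T \<subseteq> J \<longrightarrow> J \<subseteq> I \<longrightarrow> P J = P I)"
      and P2: "\<And>I. I \<subseteq> V \<Longrightarrow> I \<noteq> {} \<Longrightarrow> round_inv V (Suc l) D \<tau> w0 (fst (P I)) (snd (P I))"
      and P3: "\<And>I v. I \<subseteq> V \<Longrightarrow> v \<in> I \<Longrightarrow> real b * wdeg V (fst (P I)) {v} \<le> wdeg V (snd (P I)) {}"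
      and P4: "\<And>I. I \<subseteq> V \<Longrightarrow> I \<noteq> {} \<Longrightarrow> w_independent w0 I \<Longrightarrow> w_independent (snd (P I)) I"
      using round_exists[OF V D \<tau>(1) w0] deg by blast
    define good where "good w' f \<longleftrightarrow> (\<forall>I\<subseteq>V. I \<noteq> {} \<longrightarrow> w_independent w' I \<longrightarrow>
        I \<subseteq> f I \<and> f I \<subseteq> V \<and> real (card (f I)) \<le> (1 - \<delta>) * real (card V) \<and>
        (\<exists>T\<subseteq>I. card T \<le> l * b \<and> (\<forall>J. T \<subseteq> J \<longrightarrow> J \<subseteq> I \<longrightarrow> f J = f I)))" for w' f
    define big where "big w' \<longleftrightarrow> \<epsilon>' * \<tau> * card V * D \<le> wdeg V w' {}" for w' :: "'a set \<Rightarrow> real"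
    \<comment> \<open>One choice per \<open>w'\<close>: independent sets with the same outcome of
      the round must use the same map in the next one.\<close>
    define F where "F w' = (SOME f. good w' f)" for w'
    have F: "good (snd (P I)) (F (snd (P I)))" if I: "I \<subseteq> V" "I \<noteq> {}" and B: "big (snd (P I))" for I
    proof -
      have "\<exists>f. good (snd (P I)) f"
        unfolding good_def
      proof (rule IH[OF V \<tau> _ b])
        \<comment> \<open>The next round runs with \<open>2 * D * \<tau>\<close> for
          \<open>D\<close>, because \<open>2 * D * \<tau> ^ card X = (2 * D * \<tau>) * \<tau> ^
          (card X - 1)\<close>. This halves the relative density to
          \<open>\<epsilon>' / 2\<close>.\<close>
        show "0 < 2 * D * \<tau>" using D \<tau> by simp
        show "uniform_weight V (Suc l) (snd (P I))" using P2[OF I] by (simp add: round_inv_def)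
        show "\<epsilon>' / 2 * card V * (2 * D * \<tau>) \<le> wdeg V (snd (P I)) {}"
          using B by (simp add: big_def mult_ac)
        show "\<forall>X. X \<noteq> {} \<longrightarrow> wdeg V (snd (P I)) X \<le> 2 * D * \<tau> * \<tau> ^ (card X - 1)"
        proof (intro allI impI)
          fix X :: "'a set" assume X: "X \<noteq> {}"
          show "wdeg V (snd (P I)) X \<le> 2 * D * \<tau> * \<tau> ^ (card X - 1)"
          proof (cases "X \<subseteq> V")
            case True
            then have "card X > 0" using X V by (meson card_gt_0_iff finite_subset)
            then have "\<tau> * \<tau> ^ (card X - 1) = \<tau> ^ card X" by (simp add: power_eq_if)
            then show ?thesis using P2[OF I] X by (simp add: round_inv_def mult.assoc)
          next
            case False
            then have "wdeg V (snd (P I)) X = 0" unfolding wdeg_def by (intro sum.neutral) auto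
            then show ?thesis using D \<tau> by simp
          qed
        qed
      qed
      then show ?thesis unfolding F_def by (rule someI_ex)
    qed
    define f where "f I = (if big (snd (P I)) then F (snd (P I)) I
        else {v \<in> V. wdeg V (fst (P I)) {v} \<le> \<epsilon>' * D})" for I
    have "I \<subseteq> f I \<and> f I \<subseteq> V \<and> real (card (f I)) \<le> (1 - min \<delta> \<epsilon>') * real (card V) \<and>
        (\<exists>T\<subseteq>I. card T \<le> Suc l * b \<and> (\<forall>J. T \<subseteq> J \<longrightarrow> J \<subseteq> I \<longrightarrow> f J = f I))"
      if I: "I \<subseteq> V" "I \<noteq> {}" and ind: "w_independent w0 I" for I
    proof -
      obtain T where T: "T \<subseteq> I" "card T \<le> b" "\<And>J. T \<subseteq> J \<Longrightarrow> J \<subseteq> I \<Longrightarrow> P J = P I"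
        using P1[OF I] by blast
      have le_min: "(1 - c) * card V \<le> (1 - min \<delta> \<epsilon>') * card V" if "c = \<delta> \<or> c = \<epsilon>'" for c
        using that by (intro mult_right_mono) auto
      show ?thesis
      proof (cases "big (snd (P I))")
        case True
        have g: "good (snd (P I)) (F (snd (P I)))" using F[OF I True] .
        note g' = g[unfolded good_def, rule_format, OF I P4[OF I ind]]
        then obtain T' where T': "T' \<subseteq> I" "card T' \<le> l * b"
          "\<And>J. T' \<subseteq> J \<Longrightarrow> J \<subseteq> I \<Longrightarrow> F (snd (P I)) J = F (snd (P I)) I"
          by blast
        have "f J = f I" if "T \<union> T' \<subseteq> J" "J \<subseteq> I" for J
          using T(3)[of J] T'(3)[of J] that by (simp add: f_def)
        moreover have "card (T \<union> T') \<le> Suc l * b"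
          using card_Un_le[of T T'] T(2) T'(2) by simp
        moreover have "T \<union> T' \<subseteq> I" using T(1) T'(1) by blast
        moreover have "I \<subseteq> f I \<and> f I \<subseteq> V \<and> real (card (f I)) \<le> (1 - \<delta>) * card V"
          using g' True by (simp add: f_def)
        ultimately show ?thesis using le_min[of \<delta>] by (meson order_trans)
      next
        case False
        let ?w = "fst (P I)" and ?w' = "snd (P I)"
        have inv: "round_inv V (Suc l) D \<tau> w0 ?w ?w'" using P2[OF I] .
        have w_eq: "?w e = 0 \<or> ?w e = w0 e" for e using inv by (auto simp: round_inv_def)
        have w0n: "0 \<le> w0 e" for e using w0 by (auto simp: uniform_weight_def)
        have w_le: "?w e \<le> w0 e" for e using w_eq[of e] w0n[of e] by auto
        have w: "uniform_weight V (Suc (Suc l)) ?w"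
          unfolding uniform_weight_def
        proof (intro conjI allI impI)
          fix e show "0 \<le> ?w e" using w_eq[of e] w0n[of e] by auto
          assume "?w e \<noteq> 0"
          then have "w0 e \<noteq> 0" using w_eq[of e] by auto
          then show "e \<subseteq> V" "card e = Suc (Suc l)" using w0 by (auto simp: uniform_weight_def)
        qed
        have small': "wdeg V ?w' {} < \<epsilon>' * \<tau> * card V * D" using False by (simp add: big_def)
        have lowdeg: "wdeg V ?w {v} \<le> \<epsilon>' * D" if "v \<in> I" for v
        proof -
          have "real b * wdeg V ?w {v} \<le> \<epsilon>' * D * (\<tau> * card V)"
            using P3[OF I(1) that] small' by (simp add: mult_ac)
          also have "\<dots> \<le> \<epsilon>' * D * real b" using b \<epsilon>' D by (intro mult_left_mono) auto
          finally show ?thesis using b(2) by (simp add: mult.commute)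
        qed
        have "wdeg V w0 {} \<le> wdeg V ?w {} + (1 + 2 ^ Suc l / \<tau>) * wdeg V ?w' {}"
          using round_inv_total[OF V \<tau>(1) _ inv] deg by blast
        also have "(1 + 2 ^ Suc l / \<tau>) * wdeg V ?w' {} \<le> (1 + 2 ^ Suc l / \<tau>) * (\<epsilon>' * \<tau> * card V * D)"
          using small' \<tau> by (intro mult_left_mono) auto
        also have "\<dots> = \<epsilon>' * (\<tau> + 2 ^ Suc l) * (card V * D)" using \<tau> by (simp add: field_simps)
        also have "\<dots> \<le> \<epsilon> / 2 * (card V * D)"
        proof (rule mult_right_mono)
          have "\<epsilon>' * (\<tau> + 2 ^ Suc l) \<le> \<epsilon>' * (1 + 2 ^ Suc l)"
            using \<tau> \<epsilon>' by (intro mult_left_mono) auto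
          then show "\<epsilon>' * (\<tau> + 2 ^ Suc l) \<le> \<epsilon> / 2" using small by simp
        qed (use D in simp)
        finally have tot': "\<epsilon> / 2 * card V * D \<le> wdeg V ?w {}" using tot by (simp add: field_simps)
        have "wdeg V ?w {v} \<le> D" for v
          using wdeg_mono[of V ?w w0 "{v}"] V w_le deg[rule_format, of "{v}"] by simp
        then have "card {v \<in> V. wdeg V ?w {v} \<le> \<epsilon>' * D} \<le> (1 - (\<epsilon> / 2 - \<epsilon>')) * card V"
          using D \<epsilon>' tot' by (intro card_low_degree_le[OF V w]) auto
        also have "\<dots> \<le> (1 - \<epsilon>') * card V" using small by (intro mult_right_mono) auto
        finally have "real (card (f I)) \<le> (1 - \<epsilon>') * card V" using False by (simp add: f_def)
        moreover have "I \<subseteq> f I \<and> f I \<subseteq> V" using lowdeg I False by (auto simp: f_def)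
        moreover have "f J = f I" if "T \<subseteq> J" "J \<subseteq> I" for J using T(3)[OF that] False by (simp add: f_def)
        moreover have "card T \<le> Suc l * b" using T(2) by simp
        ultimately show ?thesis using T(1) le_min[of \<epsilon>'] by (meson order_trans)
      qed
    qed
    then show "\<exists>f. \<forall>I\<subseteq>V. I \<noteq> {} \<longrightarrow> w_independent w0 I \<longrightarrow>
        I \<subseteq> f I \<and> f I \<subseteq> V \<and> real (card (f I)) \<le> (1 - min \<delta> \<epsilon>') * real (card V) \<and>
        (\<exists>T\<subseteq>I. card T \<le> Suc l * b \<and> (\<forall>J. T \<subseteq> J \<longrightarrow> J \<subseteq> I \<longrightarrow> f J = f I))"
      by blast
  qed
qed

section \<open>A balanced weighting of the copies of $K_{s,t}$\<close>

definition esym :: "('a \<Rightarrow> real) \<Rightarrow> 'a set \<Rightarrow> nat \<Rightarrow> real" where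
  "esym f U j = (\<Sum>T | T \<subseteq> U \<and> card T = j. \<Prod>u\<in>T. f u)"

lemma esym_0: "finite U \<Longrightarrow> esym f U 0 = 1"
proof -
  assume U: "finite U"
  have "{T. T \<subseteq> U \<and> card T = 0} = {{}}" using U by (auto dest: finite_subset)
  then show ?thesis by (simp add: esym_def)
qed

text \<open>Count pairs of a \<open>j\<close>-set and a further element: each set of size
  \<open>Suc j\<close> arises from \<open>Suc j\<close> such pairs.\<close>

lemma esym_Suc:
  assumes U: "finite U"
  shows "real (Suc j) * esym f U (Suc j)
       = (\<Sum>T | T \<subseteq> U \<and> card T = j. (\<Prod>u\<in>T. f u) * (\<Sum>u\<in>U - T. f u))"
proof -
  let ?P = "\<lambda>j. {T. T \<subseteq> U \<and> card T = j}"
  have fin: "finite (?P i)" for i using U by simp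
  have finT: "finite T" if "T \<subseteq> U" for T using U that by (rule rev_finite_subset)
  have "(\<Sum>T\<in>?P j. (\<Prod>u\<in>T. f u) * (\<Sum>u\<in>U - T. f u))
      = (\<Sum>T\<in>?P j. \<Sum>u\<in>U - T. \<Prod>v\<in>insert u T. f v)"
    by (intro sum.cong) (auto simp: sum_distrib_left finT mult.commute intro!: sum.cong)
  also have "\<dots> = (\<Sum>(T, u)\<in>(SIGMA T:?P j. U - T). \<Prod>v\<in>insert u T. f v)"
    using U fin by (intro sum.Sigma) auto
  also have "\<dots> = (\<Sum>(T, u)\<in>(SIGMA T:?P (Suc j). T). \<Prod>v\<in>T. f v)"
    by (rule sum.reindex_bij_witness[of _ "\<lambda>(T, u). (T - {u}, u)" "\<lambda>(T, u). (insert u T, u)"])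
      (auto simp: finT insert_absorb)
  also have "\<dots> = (\<Sum>T\<in>?P (Suc j). \<Sum>u\<in>T. \<Prod>v\<in>T. f v)"
    using fin finT by (intro sum.Sigma[symmetric]) auto
  also have "\<dots> = real (Suc j) * esym f U (Suc j)"
    by (simp add: esym_def sum_distrib_left)
  finally show ?thesis by simp
qed

lemma esym_nonneg: "(\<And>u. u \<in> U \<Longrightarrow> 0 \<le> f u) \<Longrightarrow> 0 \<le> esym f U j"
  unfolding esym_def by (intro sum_nonneg prod_nonneg) auto

lemma esym_le:
  assumes U: "finite U" and f: "\<And>u. u \<in> U \<Longrightarrow> 0 \<le> f u"
  shows "esym f U j \<le> (\<Sum>u\<in>U. f u) ^ j"
proof (induction j)
  case (Suc j)
  have "esym f U (Suc j) \<le> real (Suc j) * esym f U (Suc j)"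
    using esym_nonneg[of U f "Suc j"] f mult_right_mono[of 1 "real (Suc j)" "esym f U (Suc j)"] by simp
  also have "\<dots> = (\<Sum>T | T \<subseteq> U \<and> card T = j. (\<Prod>u\<in>T. f u) * (\<Sum>u\<in>U - T. f u))"
    by (rule esym_Suc[OF U])
  also have "\<dots> \<le> (\<Sum>T | T \<subseteq> U \<and> card T = j. (\<Prod>u\<in>T. f u) * (\<Sum>u\<in>U. f u))"
    using U f by (intro sum_mono mult_left_mono sum_mono2 prod_nonneg) auto
  also have "\<dots> = esym f U j * (\<Sum>u\<in>U. f u)" by (simp add: esym_def sum_distrib_right)
  also have "\<dots> \<le> (\<Sum>u\<in>U. f u) ^ j * (\<Sum>u\<in>U. f u)"
    using Suc f by (intro mult_right_mono sum_nonneg) auto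
  finally show ?case by (simp add: mult.commute)
qed (use U in \<open>simp add: esym_0\<close>)

text \<open>Fewer than \<open>t\<close> elements carry at most half of the total sum, so each new
  element is chosen from at least the other half.\<close>

lemma esym_ge:
  assumes U: "finite U" and f: "\<And>u. u \<in> U \<Longrightarrow> 0 \<le> f u"
    and small: "\<And>u. u \<in> U \<Longrightarrow> 2 * real t * f u \<le> (\<Sum>u\<in>U. f u)"
  shows "j \<le> t \<Longrightarrow> ((\<Sum>u\<in>U. f u) / 2) ^ j / fact j \<le> esym f U j"
proof (induction j)
  case (Suc j)
  define c where "c = (\<Sum>u\<in>U. f u)"
  have c: "0 \<le> c" unfolding c_def using f by (intro sum_nonneg) auto
  have t: "t > 0" using Suc by simp
  have "(\<Sum>u\<in>U - T. f u) \<ge> c / 2" if T: "T \<subseteq> U" "card T = j" for T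
  proof -
    have "(\<Sum>u\<in>T. f u) \<le> card T * (c / (2 * t))"
      using small T t by (intro sum_bounded_above) (auto simp: c_def field_simps)
    also have "\<dots> \<le> real t * (c / (2 * t))" using T Suc c by (intro mult_right_mono) auto
    also have "\<dots> = c / 2" using t by simp
    finally show ?thesis using U T by (simp add: sum_diff c_def)
  qed
  then have "esym f U j * (c / 2) \<le> (\<Sum>T | T \<subseteq> U \<and> card T = j. (\<Prod>u\<in>T. f u) * (\<Sum>u\<in>U - T. f u))"
    unfolding esym_def sum_distrib_right using f by (intro sum_mono mult_left_mono prod_nonneg) auto
  also have "\<dots> = real (Suc j) * esym f U (Suc j)" by (rule esym_Suc[OF U, symmetric])
  finally have 1: "esym f U j * (c / 2) / real (Suc j) \<le> esym f U (Suc j)"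
    by (simp add: field_simps)
  have "(c / 2) ^ Suc j / fact (Suc j) = ((c / 2) ^ j / fact j) * (c / 2) / real (Suc j)"
    by (simp add: field_simps)
  also have "\<dots> \<le> esym f U j * (c / 2) / real (Suc j)"
    using Suc c by (intro divide_right_mono mult_right_mono) (auto simp: c_def)
  finally show ?case using 1 by (simp add: c_def)
qed (use U in \<open>simp add: esym_0\<close>)

text \<open>In logarithmic scale the difference of the two sides is affine in \<open>a\<close> and in \<open>b\<close>, so it
  suffices to consider the corners of \<open>[1, s] \<times> [1, t]\<close>.\<close>

lemma corner_bound:
  fixes d \<kappa> \<tau> :: real
  assumes pos: "0 < d" "0 < \<kappa>" "0 < \<tau>" and st: "2 \<le> s" "2 \<le> t"
    and c1: "1 / d \<le> \<tau>" and c2: "1 / \<kappa> \<le> \<tau>"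
    and c3: "1 / (d ^ (s - 1) * \<kappa> ^ (t - 1)) \<le> \<tau> ^ (s * t - 1)"
    and ab: "1 \<le> a" "a \<le> s" "1 \<le> b" "b \<le> t"
  shows "1 / (d ^ (a - 1) * \<kappa> ^ (b - 1)) \<le> \<tau> ^ (a * b - 1)"
proof -
  define x where "x = ln \<kappa>"
  define y where "y = ln d"
  define L where "L = - ln \<tau>"
  have ln_le: "1 / u \<le> v \<longleftrightarrow> - ln u \<le> ln v" if "u > 0" "v > 0" for u v :: real
    using that by (subst ln_le_cancel_iff[symmetric]) (auto simp: ln_div)
  have ln_iff: "1 / (d ^ (i - 1) * \<kappa> ^ (j - 1)) \<le> \<tau> ^ (i * j - 1) \<longleftrightarrow>
      (real i * real j - 1) * L \<le> (real i - 1) * y + (real j - 1) * x" if "1 \<le> i" "1 \<le> j" for i j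
  proof -
    have "1 \<le> i * j" using that by simp
    then have "real (i * j - 1) = real i * real j - 1" using of_nat_diff[of 1 "i * j"] by simp
    then show ?thesis using that pos
      by (subst ln_le) (auto simp: ln_mult ln_realpow x_def y_def L_def of_nat_diff)
  qed
  have xL: "L \<le> x" "L \<le> y" using c1 c2 pos by (auto simp: ln_le x_def y_def L_def)
  define f where "f i j = (i - 1) * y + (j - 1) * x - (i * j - 1) * L" for i j :: real
  have fst: "0 \<le> f s t" using c3 ln_iff[of s t] st by (simp add: f_def)
  have fs1: "0 \<le> f s 1"
  proof -
    have "0 \<le> (real s - 1) * (y - L)" using xL st by (intro mult_nonneg_nonneg) auto
    then show ?thesis by (simp add: f_def algebra_simps)
  qed
  have f1b: "0 \<le> f 1 b"
  proof -
    have "0 \<le> (real b - 1) * (x - L)" using xL ab by (intro mult_nonneg_nonneg) auto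
    then show ?thesis by (simp add: f_def algebra_simps)
  qed
  have "(real t - 1) * f s b = (real t - real b) * f s 1 + (real b - 1) * f s t"
    by (simp add: f_def algebra_simps)
  also have "\<dots> \<ge> 0" using fst fs1 ab by (intro add_nonneg_nonneg mult_nonneg_nonneg) auto
  finally have fsb: "0 \<le> f s b" using st by (simp add: zero_le_mult_iff)
  have "(real s - 1) * f a b = (real s - real a) * f 1 b + (real a - 1) * f s b"
    by (simp add: f_def algebra_simps)
  also have "\<dots> \<ge> 0" using f1b fsb ab by (intro add_nonneg_nonneg mult_nonneg_nonneg) auto
  finally have "0 \<le> f a b" using st by (simp add: zero_le_mult_iff)
  then show ?thesis using ln_iff[of a b] ab by (simp add: f_def)
qed

section \<open>Neighbourhoods and complete bipartite edge sets\<close>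

definition nbrs :: "'a set set \<Rightarrow> 'a \<Rightarrow> 'a set" where
  "nbrs A u = {v. {u, v} \<in> A}"

definition biclique :: "'a set \<Rightarrow> 'a set \<Rightarrow> 'a set set" where
  "biclique S T = (\<lambda>(v, u). {v, u}) ` (S \<times> T)"

lemma nbrs_subset:
  assumes "A \<subseteq> all_pairs X" shows "nbrs A u \<subseteq> X - {u}"
  using assms by (auto simp: nbrs_def all_pairs_def)

lemma finite_all_pairs: "finite X \<Longrightarrow> finite (all_pairs X)"
  by (auto simp: all_pairs_def intro: finite_subset[of _ "Pow X"])

lemma card_all_pairs_le:
  assumes "finite X" shows "card (all_pairs X) \<le> card X ^ 2"
proof -
  have "all_pairs X \<subseteq> (\<lambda>(x, y). {x, y}) ` (X \<times> X)"
  proof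
    fix e assume "e \<in> all_pairs X"
    then have "e \<subseteq> X" "card e = 2" by (auto simp: all_pairs_def)
    then obtain x y where "e = {x, y}" "x \<in> X" "y \<in> X" by (auto simp: card_2_iff)
    then show "e \<in> (\<lambda>(x, y). {x, y}) ` (X \<times> X)" by auto
  qed
  then have "card (all_pairs X) \<le> card (X \<times> X)" using assms by (intro surj_card_le) auto
  then show ?thesis by (simp add: card_cartesian_product power2_eq_square)
qed

lemma handshake:
  assumes X: "finite X" and A: "A \<subseteq> all_pairs X"
  shows "(\<Sum>u\<in>X. card (nbrs A u)) = 2 * card A"
proof -
  have finA: "finite A" using X A by (auto simp: all_pairs_def intro: finite_subset[of _ "Pow X"])
  have "card (nbrs A u) = card {e \<in> A. u \<in> e}" for u
  proof (rule bij_betw_same_card)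
    show "bij_betw (\<lambda>v. {u, v}) (nbrs A u) {e \<in> A. u \<in> e}"
    proof (rule bij_betwI')
      fix e assume e: "e \<in> {e \<in> A. u \<in> e}"
      then have "card e = 2" using A by (auto simp: all_pairs_def)
      then obtain x y where "e = {x, y}" by (auto simp: card_2_iff)
      then show "\<exists>v\<in>nbrs A u. e = {u, v}" using e by (auto simp: nbrs_def insert_commute)
    qed (auto simp: nbrs_def doubleton_eq_iff)
  qed
  then have "(\<Sum>u\<in>X. card (nbrs A u)) = (\<Sum>u\<in>X. \<Sum>e\<in>{e \<in> A. u \<in> e}. 1)" by simp
  also have "\<dots> = (\<Sum>e\<in>A. \<Sum>u\<in>{u \<in> X. u \<in> e}. 1)" using X finA by (rule sum.swap_restrict)
  also have "\<dots> = (\<Sum>e\<in>A. 2)"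
  proof (rule sum.cong)
    fix e assume "e \<in> A"
    then have "{u \<in> X. u \<in> e} = e" "card e = 2" using A by (auto simp: all_pairs_def)
    then show "(\<Sum>u\<in>{u \<in> X. u \<in> e}. 1) = (2::nat)" by simp
  qed simp
  finally show ?thesis by simp
qed

lemma card_biclique:
  assumes "finite S" "finite T" "S \<inter> T = {}"
  shows "card (biclique S T) = card S * card T"
proof -
  have "inj_on (\<lambda>(v, u). {v, u}) (S \<times> T)"
    using assms(3) by (auto simp: inj_on_def doubleton_eq_iff)
  then show ?thesis unfolding biclique_def by (simp add: card_image card_cartesian_product)
qed

lemma card_intermediate_le:
  assumes "finite N" "A \<subseteq> N" "card A \<le> s"
  shows "card {S. A \<subseteq> S \<and> S \<subseteq> N \<and> card S = s} \<le> card N ^ (s - card A)"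
proof -
  have finA: "finite A" using assms by (auto intro: finite_subset)
  have "card {S. A \<subseteq> S \<and> S \<subseteq> N \<and> card S = s} = card {S. S \<subseteq> N - A \<and> card S = s - card A}"
  proof (rule bij_betw_same_card)
    show "bij_betw (\<lambda>S. S - A) {S. A \<subseteq> S \<and> S \<subseteq> N \<and> card S = s} {S. S \<subseteq> N - A \<and> card S = s - card A}"
    proof (rule bij_betw_byWitness[where f' = "\<lambda>S. S \<union> A"])
      have "card (S \<union> A) = s" if "S \<subseteq> N - A" "card S = s - card A" for S
      proof -
        have "finite S" "S \<inter> A = {}" using that assms by (auto intro: finite_subset)
        then show ?thesis using that assms finA by (simp add: card_Un_disjoint)
      qed
      then show "(\<lambda>S. S \<union> A) ` {S. S \<subseteq> N - A \<and> card S = s - card A}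
          \<subseteq> {S. A \<subseteq> S \<and> S \<subseteq> N \<and> card S = s}" using assms by auto
    qed (use assms finA in \<open>auto simp: card_Diff_subset\<close>)
  qed
  also have "\<dots> = card (N - A) choose (s - card A)" using assms by (simp add: n_subsets)
  also have "\<dots> \<le> card (N - A) ^ (s - card A)"
    by (cases "s - card A \<le> card (N - A)") (auto simp: binomial_le_pow binomial_eq_0)
  also have "\<dots> \<le> card N ^ (s - card A)" using assms by (intro power_mono card_mono) auto
  finally show ?thesis .
qed

section \<open>The balanced weighting on a dense graph\<close>

locale dense_graph =
  fixes X :: "'a set" and A :: "'a set set" and s t :: nat
  assumes finite_X: "finite X" and A: "A \<subseteq> all_pairs X"
    and st: "2 \<le> s" "2 \<le> t"
    and deg_large: "real s * card X \<le> card A" and A_ne: "A \<noteq> {}"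
    and kappa_large: "2 * real t * (2 * real s ^ s * real (card X) ^ (2 * s - 1)) \<le> real (card A) ^ s"
begin

text \<open>\<open>d\<close> is half the average degree; vertices below it are dropped because
  \<open>f\<close> is too large there. \<open>\<gamma>\<close> is half of a lower bound for the mean
  of \<open>c S\<close> over at most \<open>card X ^ s\<close> sets, so sets that are not rich lose
  at most half of the total. \<open>\<kappa> = d ^ (s - 1) * \<gamma>\<close> is a lower bound for
  \<open>c S / f u\<close>, which would be the number of common neighbours if \<open>f\<close> were
  constant. The two numerical hypotheses of the locale say \<open>s \<le> d\<close> and
  \<open>2 * t \<le> \<kappa>\<close>.\<close>

definition "d = real (card A) / card X"
definition "\<kappa> = real (card A) ^ s / (2 * real s ^ s * real (card X) ^ (2 * s - 1))"
definition "\<gamma> = real (card A) / (2 * real s ^ s * real (card X) ^ s)"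
definition "high = {u \<in> X. d \<le> card (nbrs A u)}"
definition "f u = 1 / real (card (nbrs A u)) ^ (s - 1)"
definition "common S = {u \<in> high. S \<subseteq> nbrs A u}"
definition "c S = (\<Sum>u\<in>common S. f u)"
definition "rich = {S. S \<subseteq> X \<and> card S = s \<and> \<gamma> \<le> c S}"
definition "copies = (SIGMA S:rich. {T. T \<subseteq> common S \<and> card T = t})"
definition "wt S T = (\<Prod>u\<in>T. f u) / c S ^ (t - 1)"

lemma finite_A: "finite A"
  using finite_all_pairs[OF finite_X] A by (rule finite_subset[rotated])

lemma card_A: "card A > 0" using A_ne finite_A by auto

lemma card_X: "card X > 0"
proof -
  obtain e where "e \<in> A" using A_ne by auto
  then have "e \<subseteq> X" "card e = 2" using A by (auto simp: all_pairs_def)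
  then show ?thesis using finite_X by (metis card_gt_0_iff card.empty subset_empty zero_neq_numeral)
qed

lemma d_ge: "real s \<le> d" using deg_large card_X by (simp add: d_def field_simps)

lemma d_pos: "0 < d" using card_A card_X by (simp add: d_def)

lemma kappa_ge: "2 * real t \<le> \<kappa>"
  using kappa_large card_X st by (simp add: \<kappa>_def field_simps)

lemma kappa_pos: "0 < \<kappa>" using kappa_ge st by linarith

lemma gamma_pos: "0 < \<gamma>" using card_A card_X st by (simp add: \<gamma>_def)

lemma gamma_eq: "d ^ (s - 1) * \<gamma> = \<kappa>"
proof -
  have "s = Suc (s - 1)" "2 * s - 1 = (s - 1) + s" using st by auto
  then have "real (card A) ^ s = real (card A) ^ (s - 1) * card A"
    "real (card X) ^ (2 * s - 1) = real (card X) ^ (s - 1) * real (card X) ^ s"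
    by (metis power_Suc2, metis power_add)
  then show ?thesis by (simp add: d_def \<gamma>_def \<kappa>_def power_divide)
qed

lemma nbrs_X: "nbrs A u \<subseteq> X - {u}" using nbrs_subset[OF A] .

lemma finite_nbrs: "finite (nbrs A u)" using nbrs_X finite_X by (auto intro: finite_subset)

lemma finite_high: "finite high" using finite_X by (simp add: high_def)

lemma finite_common: "finite (common S)" using finite_high by (simp add: common_def)

lemma finite_rich: "finite rich"
  using finite_X by (auto simp: rich_def intro: finite_subset[of _ "Pow X"])

lemma finite_copies: "finite copies"
  unfolding copies_def using finite_rich finite_common by (intro finite_SigmaI) auto

lemma deg_high: "u \<in> high \<Longrightarrow> d \<le> card (nbrs A u)" by (simp add: high_def)

lemma f_nonneg: "0 \<le> f u" by (simp add: f_def)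

lemma f_high_le: assumes "u \<in> high" shows "f u \<le> 1 / d ^ (s - 1)"
  unfolding f_def using deg_high[OF assms] d_pos by (intro divide_left_mono power_mono mult_pos_pos) auto

lemma c_rich: "S \<in> rich \<Longrightarrow> \<gamma> \<le> c S" by (simp add: rich_def)

text \<open>No vertex carries more than the fraction \<open>1 / \<kappa>\<close> of
  \<open>c S\<close>. This makes \<open>esym_ge\<close> applicable and is the source of all factors
  \<open>1 / \<kappa>\<close> below.\<close>

lemma f_le_c: assumes "S \<in> rich" "u \<in> high" shows "\<kappa> * f u \<le> c S"
proof -
  have "\<kappa> * f u \<le> \<kappa> * (1 / d ^ (s - 1))"
    using kappa_pos f_high_le[OF assms(2)] by (intro mult_left_mono) auto
  also have "\<dots> = \<gamma>" using d_pos by (simp add: gamma_eq[symmetric])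
  finally show ?thesis using c_rich[OF assms(1)] by simp
qed

lemma wt_nonneg: "0 \<le> wt S T"
  unfolding wt_def c_def by (intro divide_nonneg_nonneg prod_nonneg zero_le_power sum_nonneg) (auto simp: f_nonneg)

text \<open>The other vertices account for at most \<open>card X * d = card A\<close> of the total
  degree \<open>2 * card A\<close>.\<close>

lemma total_degree_high: "real (card A) \<le> (\<Sum>u\<in>high. real (card (nbrs A u)))"
proof -
  have "2 * real (card A) = (\<Sum>u\<in>X. real (card (nbrs A u)))"
    using handshake[OF finite_X A] by (metis of_nat_mult of_nat_numeral of_nat_sum)
  also have "\<dots> = (\<Sum>u\<in>X - high. real (card (nbrs A u))) + (\<Sum>u\<in>high. real (card (nbrs A u)))"
    using finite_X by (intro sum.subset_diff) (auto simp: high_def)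
  also have "(\<Sum>u\<in>X - high. real (card (nbrs A u))) \<le> card (X - high) * d"
    by (intro sum_bounded_above) (auto simp: high_def)
  also have "\<dots> \<le> card X * d" using d_pos finite_X by (intro mult_right_mono) (auto intro: card_mono)
  also have "\<dots> = card A" using card_X by (simp add: d_def)
  finally show ?thesis by simp
qed

text \<open>After exchanging the sums, \<open>u\<close> contributes \<open>f u\<close> for each
  \<open>s\<close>-set of its neighbours. There are at least \<open>(deg(u)/s)^s\<close> of them
  since \<open>deg(u) \<ge> d \<ge> s\<close>, and \<open>f u\<close> reduces this to
  \<open>deg(u)/s^s\<close>.\<close>

lemma sum_c_all: "real (card A) / real s ^ s \<le> (\<Sum>S | S \<subseteq> X \<and> card S = s. c S)"
proof -
  have fin: "finite {S. S \<subseteq> X \<and> card S = s}" using finite_X by simp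
  have "(\<Sum>S | S \<subseteq> X \<and> card S = s. c S)
      = (\<Sum>S | S \<subseteq> X \<and> card S = s. \<Sum>u\<in>{u \<in> high. S \<subseteq> nbrs A u}. f u)"
    by (simp add: c_def common_def)
  also have "\<dots> = (\<Sum>u\<in>high. \<Sum>S\<in>{S \<in> {S. S \<subseteq> X \<and> card S = s}. S \<subseteq> nbrs A u}. f u)"
    using fin finite_high by (rule sum.swap_restrict)
  also have "\<dots> = (\<Sum>u\<in>high. real (card (nbrs A u) choose s) * f u)"
  proof (rule sum.cong)
    fix u
    have "{S \<in> {S. S \<subseteq> X \<and> card S = s}. S \<subseteq> nbrs A u} = {S. S \<subseteq> nbrs A u \<and> card S = s}"
      using nbrs_X by blast
    then show "(\<Sum>S\<in>{S \<in> {S. S \<subseteq> X \<and> card S = s}. S \<subseteq> nbrs A u}. f u) = real (card (nbrs A u) choose s) * f u"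
      using n_subsets[OF finite_nbrs] by simp
  qed simp
  also have "\<dots> \<ge> (\<Sum>u\<in>high. real (card (nbrs A u)) / real s ^ s)"
  proof (rule sum_mono)
    fix u assume u: "u \<in> high"
    let ?D = "real (card (nbrs A u))"
    have D: "real s \<le> ?D" "0 < ?D" using deg_high[OF u] d_ge d_pos by auto
    have "(?D / s) ^ s \<le> real (card (nbrs A u) choose s)"
      using binomial_ge_n_over_k_pow_k[of s "card (nbrs A u)", where 'a = real] D st by simp
    moreover have "?D / real s ^ s = (?D / s) ^ s * f u"
    proof -
      have "?D ^ s = ?D ^ (s - 1) * ?D" using st by (metis Suc_diff_1 less_le_trans pos2 power_Suc2)
      then show ?thesis using D by (simp add: f_def power_divide)
    qed
    ultimately show "?D / real s ^ s \<le> real (card (nbrs A u) choose s) * f u"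
      using f_nonneg by (simp add: mult_right_mono)
  qed
  finally have "(\<Sum>u\<in>high. real (card (nbrs A u)) / real s ^ s) \<le> (\<Sum>S | S \<subseteq> X \<and> card S = s. c S)" .
  moreover have "real (card A) / real s ^ s \<le> (\<Sum>u\<in>high. real (card (nbrs A u)) / real s ^ s)"
    using total_degree_high by (simp add: sum_divide_distrib[symmetric] divide_right_mono)
  ultimately show ?thesis by simp
qed

lemma sum_c_rich: "real (card A) / (2 * real s ^ s) \<le> (\<Sum>S\<in>rich. c S)"
proof -
  let ?P = "{S. S \<subseteq> X \<and> card S = s}"
  have fin: "finite ?P" using finite_X by simp
  have "(\<Sum>S\<in>?P. c S) = (\<Sum>S\<in>?P - rich. c S) + (\<Sum>S\<in>rich. c S)"
    using fin by (intro sum.subset_diff) (auto simp: rich_def)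
  also have "(\<Sum>S\<in>?P - rich. c S) \<le> card (?P - rich) * \<gamma>"
    by (intro sum_bounded_above) (auto simp: rich_def)
  also have "\<dots> \<le> real (card X) ^ s * \<gamma>"
  proof (rule mult_right_mono)
    have "card (?P - rich) \<le> card ?P" using fin by (intro card_mono) auto
    also have "\<dots> \<le> card X ^ s"
      using card_intermediate_le[OF finite_X, of "{}" s] by simp
    finally show "real (card (?P - rich)) \<le> real (card X) ^ s"
      by (metis of_nat_le_iff of_nat_power)
  qed (use gamma_pos in simp)
  also have "\<dots> = real (card A) / (2 * real s ^ s)" using card_X by (simp add: \<gamma>_def)
  finally show ?thesis using sum_c_all by (simp add: field_simps)
qed

text \<open>For fixed \<open>S\<close> the products over all \<open>t\<close>-sets sum to order
  \<open>c S ^ t\<close>; the normalisation by \<open>c S ^ (t - 1)\<close> leaves a multiple of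
  \<open>c S\<close>, and the rich sets keep enough of the sum of these.\<close>

lemma total_weight:
  "real (card A) / (2 * real s ^ s * 2 ^ t * fact t) \<le> (\<Sum>(S, T)\<in>copies. wt S T)"
proof -
  have "c S / (2 ^ t * fact t) \<le> (\<Sum>T | T \<subseteq> common S \<and> card T = t. wt S T)" if S: "S \<in> rich" for S
  proof -
    have c: "0 < c S" using c_rich[OF S] gamma_pos by simp
    have small: "2 * real t * f u \<le> (\<Sum>u\<in>common S. f u)" if "u \<in> common S" for u
    proof -
      have "2 * real t * f u \<le> \<kappa> * f u" using kappa_ge f_nonneg by (intro mult_right_mono) auto
      also have "\<dots> \<le> c S" using f_le_c[OF S] that by (auto simp: common_def)
      finally show ?thesis by (simp add: c_def)
    qed
    have "(c S / 2) ^ t / fact t \<le> esym f (common S) t"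
      using esym_ge[OF finite_common, of S f t t] small f_nonneg by (simp add: c_def)
    moreover have "(c S / 2) ^ t / fact t / c S ^ (t - 1) = c S / (2 ^ t * fact t)"
    proof -
      have "c S ^ t = c S ^ (t - 1) * c S" using st by (metis Suc_diff_1 less_le_trans pos2 power_Suc2)
      then show ?thesis using c by (simp add: power_divide)
    qed
    ultimately have "c S / (2 ^ t * fact t) \<le> esym f (common S) t / c S ^ (t - 1)"
      using c by (metis divide_right_mono less_imp_le zero_le_power)
    then show ?thesis by (simp add: esym_def wt_def sum_divide_distrib)
  qed
  then have "(\<Sum>S\<in>rich. c S / (2 ^ t * fact t)) \<le> (\<Sum>S\<in>rich. \<Sum>T | T \<subseteq> common S \<and> card T = t. wt S T)"
    by (intro sum_mono)
  also have "\<dots> = (\<Sum>(S, T)\<in>copies. wt S T)"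
    unfolding copies_def using finite_rich finite_common by (intro sum.Sigma) auto
  finally have "(\<Sum>S\<in>rich. c S) / (2 ^ t * fact t) \<le> (\<Sum>(S, T)\<in>copies. wt S T)"
    by (simp add: sum_divide_distrib)
  moreover have "real (card A) / (2 * real s ^ s) / (2 ^ t * fact t) \<le> (\<Sum>S\<in>rich. c S) / (2 ^ t * fact t)"
    using sum_c_rich by (intro divide_right_mono) auto
  ultimately show ?thesis by (simp add: mult.assoc)
qed

text \<open>Keep \<open>f u\<close>, bound each of the other \<open>card B - 1\<close> factors from
  \<open>B\<close> by \<open>c S / \<kappa>\<close>, and sum the rest of \<open>T\<close> to at most
  \<open>c S ^ (t - card B)\<close>. The powers of \<open>c S\<close> cancel exactly.\<close>

lemma weight_extending_right:
  assumes S: "S \<in> rich" and B: "B \<subseteq> common S" "card B \<le> t" and u: "u \<in> B"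
  shows "(\<Sum>T | B \<subseteq> T \<and> T \<subseteq> common S \<and> card T = t. wt S T) \<le> f u / \<kappa> ^ (card B - 1)"
proof -
  have c: "0 < c S" using c_rich[OF S] gamma_pos by simp
  have finB: "finite B" using B finite_common by (auto intro: finite_subset)
  have b: "card B \<ge> 1" using u finB by (auto simp: Suc_le_eq card_gt_0_iff)
  have "(\<Sum>T | B \<subseteq> T \<and> T \<subseteq> common S \<and> card T = t. \<Prod>u\<in>T. f u)
      = (\<Sum>T | T \<subseteq> common S - B \<and> card T = t - card B. (\<Prod>u\<in>B. f u) * (\<Prod>u\<in>T. f u))"
  proof (rule sum.reindex_bij_witness[of _ "\<lambda>T. B \<union> T" "\<lambda>T. T - B"])
    fix T assume T: "T \<in> {T. B \<subseteq> T \<and> T \<subseteq> common S \<and> card T = t}"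
    then have "finite T" using finite_common by (auto intro: finite_subset)
    then show "(\<Prod>u\<in>B. f u) * (\<Prod>u\<in>T - B. f u) = (\<Prod>u\<in>T. f u)"
      using prod.subset_diff[of B T f] T by (simp add: mult.commute)
    show "T - B \<in> {T. T \<subseteq> common S - B \<and> card T = t - card B}"
      using T finB by (auto simp: card_Diff_subset)
  next
    fix T assume T: "T \<in> {T. T \<subseteq> common S - B \<and> card T = t - card B}"
    then have "finite T" "B \<inter> T = {}" using finite_common by (auto intro: finite_subset)
    then show "B \<union> T \<in> {T. B \<subseteq> T \<and> T \<subseteq> common S \<and> card T = t}"
      using T B finB by (auto simp: card_Un_disjoint)
  qed (use B in auto)
  also have "\<dots> = (\<Prod>u\<in>B. f u) * esym f (common S - B) (t - card B)"
    by (simp add: esym_def sum_distrib_left)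
  also have "\<dots> \<le> (\<Prod>u\<in>B. f u) * (\<Sum>u\<in>common S - B. f u) ^ (t - card B)"
    using finite_common f_nonneg by (intro mult_left_mono esym_le prod_nonneg) auto
  also have "\<dots> \<le> (\<Prod>u\<in>B. f u) * c S ^ (t - card B)"
    unfolding c_def using finite_common f_nonneg
    by (intro mult_left_mono power_mono sum_mono2 prod_nonneg sum_nonneg) auto
  also have "(\<Prod>u\<in>B. f u) = f u * (\<Prod>v\<in>B - {u}. f v)" using prod.remove[OF finB u] .
  also have "\<dots> \<le> f u * (\<Prod>v\<in>B - {u}. c S / \<kappa>)"
    using f_le_c[OF S] B f_nonneg kappa_pos
    by (intro mult_left_mono prod_mono) (auto simp: common_def field_simps)
  also have "\<dots> = f u * (c S / \<kappa>) ^ (card B - 1)" using u finB by simp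
  finally have *: "(\<Sum>T | B \<subseteq> T \<and> T \<subseteq> common S \<and> card T = t. \<Prod>u\<in>T. f u)
      \<le> f u * (c S / \<kappa>) ^ (card B - 1) * c S ^ (t - card B)"
    using c by (simp add: mult_right_mono)
  have "c S ^ (card B - 1) * c S ^ (t - card B) = c S ^ (t - 1)"
    using b B by (simp add: power_add[symmetric])
  then have "f u * (c S / \<kappa>) ^ (card B - 1) * c S ^ (t - card B) = f u / \<kappa> ^ (card B - 1) * c S ^ (t - 1)"
    by (simp add: power_divide)
  then have "(\<Sum>T | B \<subseteq> T \<and> T \<subseteq> common S \<and> card T = t. \<Prod>u\<in>T. f u) / c S ^ (t - 1) \<le> f u / \<kappa> ^ (card B - 1)"
    using * c by (simp add: divide_le_eq)
  then show ?thesis by (simp add: wt_def sum_divide_distrib)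
qed

text \<open>A single vertex \<open>u \<in> Q\<close> already limits the number of \<open>S\<close> to \<open>deg(u)^(s-a)\<close>; the other
  vertices of \<open>Q\<close> only contribute factors \<open>f/c(S) \<le> 1/\<kappa>\<close>.\<close>

lemma weight_extending:
  assumes a: "a = card P" "P \<noteq> {}" and b: "b = card Q" "Q \<noteq> {}"
  shows "(\<Sum>(S, T)\<in>{(S, T) \<in> copies. P \<subseteq> S \<and> Q \<subseteq> T}. wt S T) \<le> 1 / (d ^ (a - 1) * \<kappa> ^ (b - 1))"
proof (cases "{(S, T) \<in> copies. P \<subseteq> S \<and> Q \<subseteq> T} = {}")
  case True
  show ?thesis unfolding True using d_pos kappa_pos by simp
next
  case False
  then obtain S0 T0 where 0: "S0 \<in> rich" "T0 \<subseteq> common S0" "card T0 = t" "P \<subseteq> S0" "Q \<subseteq> T0"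
    by (auto simp: copies_def)
  obtain u where u: "u \<in> Q" using b by auto
  have fin: "finite S0" "finite T0" using 0 finite_common finite_X by (auto simp: rich_def intro: finite_subset)
  have uh: "u \<in> high" and Pu: "P \<subseteq> nbrs A u" using u 0 by (auto simp: common_def)
  have bt: "card Q \<le> t" using 0 fin by (metis card_mono)
  have "finite P" using 0(4) fin(1) by (rule finite_subset)
  then have a1: "a \<ge> 1" using a by (auto simp: Suc_le_eq card_gt_0_iff)
  have "card S0 = s" using 0(1) by (simp add: rich_def)
  then have as: "card P \<le> s" using card_mono[OF fin(1) 0(4)] by simp
  define R where "R = {S \<in> rich. P \<subseteq> S \<and> Q \<subseteq> common S}"
  let ?D = "real (card (nbrs A u))"
  have D: "d \<le> ?D" "0 < ?D" using deg_high[OF uh] d_pos by auto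
  have "{(S, T) \<in> copies. P \<subseteq> S \<and> Q \<subseteq> T} = (SIGMA S:R. {T. Q \<subseteq> T \<and> T \<subseteq> common S \<and> card T = t})"
    by (auto simp: copies_def R_def)
  then have "(\<Sum>(S, T)\<in>{(S, T) \<in> copies. P \<subseteq> S \<and> Q \<subseteq> T}. wt S T)
      = (\<Sum>S\<in>R. \<Sum>T | Q \<subseteq> T \<and> T \<subseteq> common S \<and> card T = t. wt S T)"
    using finite_rich finite_common by (simp add: sum.Sigma R_def)
  also have "\<dots> \<le> card R * (f u / \<kappa> ^ (card Q - 1))"
    using bt u by (intro sum_bounded_above weight_extending_right) (auto simp: R_def)
  also have "\<dots> \<le> ?D ^ (s - a) * (f u / \<kappa> ^ (card Q - 1))"
  proof (rule mult_right_mono)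
    have "card R \<le> card {S. P \<subseteq> S \<and> S \<subseteq> nbrs A u \<and> card S = s}"
      using finite_nbrs u by (intro card_mono) (auto simp: R_def rich_def common_def)
    also have "\<dots> \<le> card (nbrs A u) ^ (s - a)"
      unfolding a(1) using card_intermediate_le[OF finite_nbrs Pu as] .
    finally show "real (card R) \<le> ?D ^ (s - a)" by (metis of_nat_le_iff of_nat_power)
  qed (use f_nonneg kappa_pos in auto)
  \<comment> \<open>The exponent \<open>s - 1\<close> in \<open>f\<close> is designed for this
    cancellation: \<open>deg(u)\<close> survives only with a nonpositive exponent, so the minimum
    degree \<open>d\<close> is the worst case.\<close>
  also have "?D ^ (s - a) * (f u / \<kappa> ^ (card Q - 1)) = 1 / (?D ^ (a - 1) * \<kappa> ^ (b - 1))"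
  proof -
    have "?D ^ (s - 1) = ?D ^ (s - a) * ?D ^ (a - 1)"
      using a1 as a by (simp add: power_add[symmetric])
    then show ?thesis using D b by (simp add: f_def)
  qed
  also have "\<dots> \<le> 1 / (d ^ (a - 1) * \<kappa> ^ (b - 1))"
    using D d_pos kappa_pos by (intro divide_left_mono mult_right_mono power_mono mult_pos_pos) auto
  finally show ?thesis .
qed

text \<open>An edge set can come from several pairs, for instance from \<open>(S, T)\<close> and
  \<open>(T, S)\<close> if \<open>s = t\<close>. Adding their weights turns degrees into plain sums
  over pairs.\<close>

definition "w E = (\<Sum>(S, T)\<in>{(S, T) \<in> copies. biclique S T = E}. wt S T)"

lemma copiesD:
  assumes "(S, T) \<in> copies"
  shows "S \<subseteq> X" "card S = s" "T \<subseteq> X" "card T = t" "S \<inter> T = {}" "finite S" "finite T" "biclique S T \<subseteq> A"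
proof -
  show "S \<subseteq> X" "card S = s" "T \<subseteq> X" "card T = t"
    using assms by (auto simp: copies_def rich_def common_def high_def)
  then show "finite S" "finite T" using finite_X by (auto intro: finite_subset)
  have *: "S \<subseteq> nbrs A u" if "u \<in> T" for u using assms that by (auto simp: copies_def common_def)
  then show "S \<inter> T = {}" using nbrs_X by blast
  show "biclique S T \<subseteq> A" using * by (fastforce simp: biclique_def nbrs_def insert_commute)
qed

lemma w_nonzeroD:
  assumes "w E \<noteq> 0"
  obtains S T where "(S, T) \<in> copies" "E = biclique S T"
proof -
  obtain p where "p \<in> {(S, T) \<in> copies. biclique S T = E}"
    using assms unfolding w_def by (rule sum.not_neutral_contains_not_neutral)
  then show ?thesis using that by auto
qed

lemma uniform_w: "uniform_weight A (s * t) w"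
  unfolding uniform_weight_def
proof (intro conjI allI impI)
  fix E show "0 \<le> w E" unfolding w_def using wt_nonneg by (intro sum_nonneg) auto
  assume "w E \<noteq> 0"
  then obtain S T where "(S, T) \<in> copies" "E = biclique S T" by (rule w_nonzeroD)
  then show "E \<subseteq> A" "card E = s * t" using copiesD[of S T] card_biclique[of S T] by auto
qed

lemma wdeg_w: "wdeg A w \<sigma> = (\<Sum>(S, T)\<in>{(S, T) \<in> copies. \<sigma> \<subseteq> biclique S T}. wt S T)"
proof -
  let ?C = "{(S, T) \<in> copies. \<sigma> \<subseteq> biclique S T}"
  have fin: "finite ?C" using finite_copies by (rule rev_finite_subset) auto
  have "wdeg A w \<sigma> = (\<Sum>E | E \<subseteq> A \<and> \<sigma> \<subseteq> E. \<Sum>p\<in>{p \<in> ?C. (\<lambda>(S, T). biclique S T) p = E}. (\<lambda>(S, T). wt S T) p)"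
    unfolding wdeg_def w_def by (intro sum.cong) auto
  also have "\<dots> = (\<Sum>p\<in>?C. (\<lambda>(S, T). wt S T) p)"
    using fin finite_A by (intro sum.group) (auto dest: copiesD)
  finally show ?thesis .
qed

text \<open>Let \<open>W\<close> be the vertex set of \<open>\<sigma>\<close>. A copy through
  \<open>\<sigma>\<close> splits \<open>W\<close> into \<open>P = S \<inter> W\<close> and
  \<open>W - P = T \<inter> W\<close>, and \<open>\<sigma>\<close> has at most
  \<open>card P * card (W - P)\<close> edges. \<open>weight_extending\<close> and
  \<open>corner_bound\<close> handle each split; the factor \<open>2 ^ (s + t)\<close> bounds the
  number of splits.\<close>

lemma wdeg_w_le:
  assumes \<tau>: "0 < \<tau>" "\<tau> \<le> 1" and c1: "1 / d \<le> \<tau>" and c2: "1 / \<kappa> \<le> \<tau>"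
    and c3: "1 / (d ^ (s - 1) * \<kappa> ^ (t - 1)) \<le> \<tau> ^ (s * t - 1)" and \<sigma>: "\<sigma> \<noteq> {}"
  shows "wdeg A w \<sigma> \<le> 2 ^ (s + t) * \<tau> ^ (card \<sigma> - 1)"
proof -
  define W where "W = \<Union>\<sigma>"
  define C where "C = {(S, T) \<in> copies. \<sigma> \<subseteq> biclique S T}"
  have finC: "finite C" unfolding C_def using finite_copies by (rule rev_finite_subset) auto
  show ?thesis
  proof (cases "C = {}")
    case True
    then have "wdeg A w \<sigma> = 0" using wdeg_w[of \<sigma>] unfolding C_def[symmetric] by simp
    then show ?thesis using \<tau> by simp
  next
    case False
    have CW: "S \<inter> W \<noteq> {}" "T \<inter> W \<noteq> {}" "W - S = T \<inter> W" "W \<subseteq> S \<union> T"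
      "\<sigma> \<subseteq> biclique (S \<inter> W) (T \<inter> W)" "S \<inter> T = {}" "finite S" "finite T" "card S = s" "card T = t"
      if "(S, T) \<in> C" for S T
    proof -
      have st: "(S, T) \<in> copies" "\<sigma> \<subseteq> biclique S T" using that by (auto simp: C_def)
      show dis: "S \<inter> T = {}" "finite S" "finite T" "card S = s" "card T = t" using copiesD[OF st(1)] by auto
      obtain e where e: "e \<in> \<sigma>" using \<sigma> by auto
      then obtain v u where "e = {v, u}" "v \<in> S" "u \<in> T" using st by (auto simp: biclique_def)
      then show "S \<inter> W \<noteq> {}" "T \<inter> W \<noteq> {}" using e by (auto simp: W_def)
      show WS: "W \<subseteq> S \<union> T" using st by (auto simp: W_def biclique_def)
      then show "W - S = T \<inter> W" using dis by auto
      show "\<sigma> \<subseteq> biclique (S \<inter> W) (T \<inter> W)"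
      proof
        fix e assume e: "e \<in> \<sigma>"
        then obtain v u where vu: "e = {v, u}" "v \<in> S" "u \<in> T" using st by (auto simp: biclique_def)
        then have "v \<in> W" "u \<in> W" using e by (auto simp: W_def)
        then show "e \<in> biclique (S \<inter> W) (T \<inter> W)" using vu by (force simp: biclique_def)
      qed
    qed
    obtain S0 T0 where "(S0, T0) \<in> C" using False by auto
    note C0 = CW[OF this]
    have finW: "finite W" using C0 by (auto intro: finite_subset)
    have "card W \<le> s + t"
      using card_mono[OF _ C0(4)] C0 card_Un_le[of S0 T0] by simp
    have "wdeg A w \<sigma> = (\<Sum>p\<in>C. (\<lambda>(S, T). wt S T) p)" by (simp add: wdeg_w C_def)
    also have "\<dots> = (\<Sum>P\<in>Pow W. \<Sum>p\<in>{p \<in> C. (\<lambda>(S, T). S \<inter> W) p = P}. (\<lambda>(S, T). wt S T) p)"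
      using finC finW by (intro sum.group[symmetric]) auto
    also have "\<dots> \<le> card (Pow W) * \<tau> ^ (card \<sigma> - 1)"
    proof (rule sum_bounded_above)
      fix P assume P: "P \<in> Pow W"
      let ?F = "{p \<in> C. (\<lambda>(S, T). S \<inter> W) p = P}"
      show "(\<Sum>p\<in>?F. (\<lambda>(S, T). wt S T) p) \<le> \<tau> ^ (card \<sigma> - 1)"
      proof (cases "?F = {}")
        case True show ?thesis unfolding True using \<tau> by simp
      next
        case False
        then obtain S T where ST: "(S, T) \<in> C" "S \<inter> W = P" by auto
        note C1 = CW[OF ST(1)]
        have fin: "finite P" "finite (W - P)" using P finW by (auto intro: finite_subset)
        have WP: "W - P = T \<inter> W" using C1(3) ST by auto
        have ne: "P \<noteq> {}" "W - P \<noteq> {}" using C1 ST WP by auto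
        have le: "card P \<le> s" "card (W - P) \<le> t"
          using C1 ST WP by (metis card_mono inf_le1)+
        have ge: "1 \<le> card P" "1 \<le> card (W - P)" using ne fin by (auto simp: Suc_le_eq card_gt_0_iff)
        have "card \<sigma> \<le> card (biclique P (W - P))"
          using C1(5) ST WP fin by (intro card_mono) (auto simp: biclique_def)
        also have "\<dots> = card P * card (W - P)" using fin by (intro card_biclique) auto
        finally have j: "card \<sigma> - 1 \<le> card P * card (W - P) - 1" by simp
        have "?F \<subseteq> {(S, T) \<in> copies. P \<subseteq> S \<and> W - P \<subseteq> T}"
        proof
          fix p assume "p \<in> ?F"
          then obtain S T where p: "p = (S, T)" "(S, T) \<in> C" "S \<inter> W = P" by (cases p) auto
          have "W - P = T \<inter> W" using CW(3)[OF p(2)] p by auto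
          then show "p \<in> {(S, T) \<in> copies. P \<subseteq> S \<and> W - P \<subseteq> T}" using p by (auto simp: C_def)
        qed
        then have "(\<Sum>p\<in>?F. (\<lambda>(S, T). wt S T) p)
            \<le> (\<Sum>(S, T)\<in>{(S, T) \<in> copies. P \<subseteq> S \<and> W - P \<subseteq> T}. wt S T)"
          using finite_copies wt_nonneg
          by (intro sum_mono2) (auto intro: finite_subset[OF _ finite_copies])
        also have "\<dots> \<le> 1 / (d ^ (card P - 1) * \<kappa> ^ (card (W - P) - 1))"
          using ne by (intro weight_extending) auto
        also have "\<dots> \<le> \<tau> ^ (card P * card (W - P) - 1)"
          using corner_bound[OF d_pos kappa_pos \<tau>(1) st c1 c2 c3 ge(1) le(1) ge(2) le(2)] .
        also have "\<dots> \<le> \<tau> ^ (card \<sigma> - 1)" using \<tau> j by (intro power_decreasing) auto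
        finally show ?thesis .
      qed
    qed
    also have "\<dots> \<le> 2 ^ (s + t) * \<tau> ^ (card \<sigma> - 1)"
    proof (rule mult_right_mono)
      have "(2::real) ^ card W \<le> 2 ^ (s + t)" using \<open>card W \<le> s + t\<close> by (intro power_increasing) auto
      then show "real (card (Pow W)) \<le> 2 ^ (s + t)" using finW by (simp add: card_Pow)
    qed (use \<tau> in simp)
    finally show ?thesis .
  qed
qed

lemma wdeg_w_empty: "real (card A) / (2 * real s ^ s * 2 ^ t * fact t) \<le> wdeg A w {}"
  using total_weight by (simp add: wdeg_w)

end

section \<open>A generating function for $K_{s,t}$-free graphs\<close>

definition bipfree :: "nat \<Rightarrow> nat \<Rightarrow> 'a set set \<Rightarrow> bool" where
  "bipfree s t I \<longleftrightarrow> \<not> (\<exists>S T. card S = s \<and> card T = t \<and> S \<inter> T = {} \<and> biclique S T \<subseteq> I)"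

definition free_sum :: "nat \<Rightarrow> nat \<Rightarrow> real \<Rightarrow> 'a set set \<Rightarrow> real" where
  "free_sum s t q A = (\<Sum>I | I \<subseteq> A \<and> bipfree s t I. q ^ card I)"

lemma bipfree_subset: "bipfree s t I \<Longrightarrow> J \<subseteq> I \<Longrightarrow> bipfree s t J"
  unfolding bipfree_def by blast

lemma sum_Pow_power_card:
  fixes x :: real
  assumes "finite A" shows "(\<Sum>T\<in>Pow A. x ^ card T) = (1 + x) ^ card A"
  using prod_add[OF assms, of "\<lambda>_. x" "\<lambda>_. 1"] by (simp add: add.commute)

lemma free_sum_le_exp:
  assumes "finite A" "0 \<le> q" shows "free_sum s t q A \<le> exp (q * card A)"
proof -
  have "free_sum s t q A \<le> (\<Sum>I\<in>Pow A. q ^ card I)"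
    unfolding free_sum_def using assms by (intro sum_mono2) auto
  also have "\<dots> = (1 + q) ^ card A" using assms by (simp add: sum_Pow_power_card)
  also have "\<dots> \<le> exp q ^ card A" using assms by (intro power_mono) auto
  also have "\<dots> = exp (q * card A)" by (rule exp_of_nat2_mult[symmetric])
  finally show ?thesis .
qed

text \<open>Exponential Markov bound: insert the factor
  \<open>\<theta> ^ card T / \<theta> ^ b \<ge> 1\<close> and sum over all subsets.\<close>

lemma sum_small_subsets_le:
  fixes q \<theta> :: real
  assumes "finite A" "0 \<le> q" "0 < \<theta>" "\<theta> \<le> 1"
  shows "(\<Sum>T | T \<subseteq> A \<and> card T \<le> b. q ^ card T) \<le> exp (q * \<theta> * card A) / \<theta> ^ b"
proof -
  have "(\<Sum>T | T \<subseteq> A \<and> card T \<le> b. q ^ card T) \<le> (\<Sum>T | T \<subseteq> A \<and> card T \<le> b. (q * \<theta>) ^ card T / \<theta> ^ b)"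
  proof (rule sum_mono)
    fix T assume "T \<in> {T. T \<subseteq> A \<and> card T \<le> b}"
    then have "\<theta> ^ b \<le> \<theta> ^ card T" using assms by (intro power_decreasing) auto
    then have "q ^ card T * \<theta> ^ b \<le> q ^ card T * \<theta> ^ card T" using assms by (intro mult_left_mono) auto
    then show "q ^ card T \<le> (q * \<theta>) ^ card T / \<theta> ^ b"
      using assms by (simp add: field_simps power_mult_distrib)
  qed
  also have "\<dots> \<le> (\<Sum>T\<in>Pow A. (q * \<theta>) ^ card T / \<theta> ^ b)" using assms by (intro sum_mono2) auto
  also have "\<dots> = (1 + q * \<theta>) ^ card A / \<theta> ^ b"
    using assms by (simp add: sum_divide_distrib[symmetric] sum_Pow_power_card)
  also have "\<dots> \<le> exp (q * \<theta>) ^ card A / \<theta> ^ b"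
    using assms by (intro divide_right_mono power_mono) auto
  also have "\<dots> = exp (q * \<theta> * card A) / \<theta> ^ b" by (simp add: exp_of_nat2_mult)
  finally show ?thesis .
qed

text \<open>Since \<open>f I = f T\<close> for the fingerprint \<open>T\<close> of \<open>I\<close>, the pair \<open>(T, I - T)\<close> determines \<open>I\<close> and
  \<open>I - T\<close> lies in a set that depends only on \<open>T\<close>.\<close>

lemma free_sum_container:
  fixes c q :: real
  assumes A: "finite A" and q: "0 < q" and c: "0 \<le> c"
    and f: "container_map (bipfree s t) A c b f"
    and B: "\<And>A'. A' \<subseteq> A \<Longrightarrow> real (card A') \<le> c \<Longrightarrow> free_sum s t q A' \<le> B"
  shows "free_sum s t q A \<le> (\<Sum>T | T \<subseteq> A \<and> card T \<le> b. q ^ card T) * B"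
proof -
  \<comment> \<open>On sets that are not fingerprints \<open>f\<close> is arbitrary; the default
    \<open>{}\<close> keeps the bound \<open>B\<close> valid for every \<open>T\<close>.\<close>
  define g where "g T = (if f T \<subseteq> A \<and> real (card (f T)) \<le> c then f T else {})" for T
  define F where "F = {I. I \<subseteq> A \<and> bipfree s t I}"
  define \<T> where "\<T> = {T. T \<subseteq> A \<and> card T \<le> b}"
  have fin: "finite F" "finite \<T>" using A by (auto simp: F_def \<T>_def)
  \<comment> \<open>A \<open>container_map\<close> says nothing about the empty set, for which
    \<open>T = {}\<close> works with any \<open>g\<close>.\<close>
  have "\<exists>T\<subseteq>I. card T \<le> b \<and> I - T \<subseteq> g T" if I: "I \<in> F" for I
  proof (cases "I = {}")
    case False
    have I': "I \<subseteq> A" "bipfree s t I" using I by (auto simp: F_def)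
    note fI = f[unfolded container_map_def, rule_format, OF I'(1) False I'(2)]
    then obtain T where T: "T \<subseteq> I" "card T \<le> b" "\<forall>J. T \<subseteq> J \<longrightarrow> J \<subseteq> I \<longrightarrow> f J = f I" by blast
    have "f T = f I" using T(3)[rule_format, of T] T(1) by simp
    then have "g T = f I" using fI by (simp add: g_def)
    then show ?thesis using T(1,2) fI by (intro exI[of _ T]) auto
  qed auto
  then obtain \<phi> where \<phi>: "\<And>I. I \<in> F \<Longrightarrow> \<phi> I \<subseteq> I \<and> card (\<phi> I) \<le> b \<and> I - \<phi> I \<subseteq> g (\<phi> I)"
    by metis
  define \<psi> where "\<psi> I = (\<phi> I, I - \<phi> I)" for I
  have gA: "g T \<subseteq> A" "real (card (g T)) \<le> c" for T using c by (auto simp: g_def)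
  have finG: "finite {I'. I' \<subseteq> g T \<and> bipfree s t I'}" for T
    using finite_subset[OF gA(1) A, of T] by simp
  have inj: "inj_on \<psi> F"
  proof (rule inj_onI)
    fix I J assume "I \<in> F" "J \<in> F" "\<psi> I = \<psi> J"
    then show "I = J" using \<phi>[of I] \<phi>[of J] unfolding \<psi>_def by blast
  qed
  have "free_sum s t q A = (\<Sum>I\<in>F. q ^ card (fst (\<psi> I)) * q ^ card (snd (\<psi> I)))"
    unfolding free_sum_def F_def[symmetric]
  proof (rule sum.cong)
    fix I assume I: "I \<in> F"
    then have "finite I" "\<phi> I \<subseteq> I" using A \<phi>[OF I] by (auto simp: F_def intro: finite_subset)
    then have "card I = card (\<phi> I) + card (I - \<phi> I)"
      using finite_subset[of "\<phi> I" I] card_mono[of I "\<phi> I"] by (simp add: card_Diff_subset)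
    then show "q ^ card I = q ^ card (fst (\<psi> I)) * q ^ card (snd (\<psi> I))"
      by (simp add: \<psi>_def power_add)
  qed simp
  also have "\<dots> = (\<Sum>p\<in>\<psi> ` F. q ^ card (fst p) * q ^ card (snd p))"
    using inj by (simp add: sum.reindex)
  also have "\<dots> \<le> (\<Sum>p\<in>(SIGMA T:\<T>. {I'. I' \<subseteq> g T \<and> bipfree s t I'}). q ^ card (fst p) * q ^ card (snd p))"
  proof (rule sum_mono2)
    show "finite (SIGMA T:\<T>. {I'. I' \<subseteq> g T \<and> bipfree s t I'})"
      using fin finG by (intro finite_SigmaI) auto
    show "\<psi> ` F \<subseteq> (SIGMA T:\<T>. {I'. I' \<subseteq> g T \<and> bipfree s t I'})"
    proof (rule image_subsetI)
      fix I assume I: "I \<in> F"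
      then have "\<phi> I \<in> \<T>" using \<phi>[OF I] by (auto simp: F_def \<T>_def)
      moreover have "bipfree s t (I - \<phi> I)" using I by (auto simp: F_def intro: bipfree_subset)
      ultimately show "\<psi> I \<in> (SIGMA T:\<T>. {I'. I' \<subseteq> g T \<and> bipfree s t I'})"
        using \<phi>[OF I] by (auto simp: \<psi>_def)
    qed
  qed (use q in auto)
  also have "\<dots> = (\<Sum>T\<in>\<T>. q ^ card T * free_sum s t q (g T))"
    unfolding free_sum_def using fin finG by (simp add: sum.Sigma sum_distrib_left split_def)
  also have "\<dots> \<le> (\<Sum>T\<in>\<T>. q ^ card T * B)"
    using gA B q by (intro sum_mono mult_left_mono) auto
  finally show ?thesis by (simp add: \<T>_def sum_distrib_right)
qed

section \<open>The container step for graphs without K_{s,t}\<close>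

lemma biclique_container:
  assumes "2 \<le> s" "2 \<le> t"
  shows "\<exists>\<delta>>0. \<forall>(X :: 'a set) A \<tau> b. dense_graph X A s t \<longrightarrow> 0 < \<tau> \<longrightarrow> \<tau> \<le> 1 \<longrightarrow>
     1 / dense_graph.d X A \<le> \<tau> \<longrightarrow> 1 / dense_graph.\<kappa> X A s \<le> \<tau> \<longrightarrow>
     1 / (dense_graph.d X A ^ (s - 1) * dense_graph.\<kappa> X A s ^ (t - 1)) \<le> \<tau> ^ (s * t - 1) \<longrightarrow>
     \<tau> * card A \<le> real b \<longrightarrow>
     (\<exists>f. container_map (bipfree s t) A ((1 - \<delta>) * real (card A)) (s * t * b) f)"
proof -
  \<comment> \<open>Lower bound for the total weight divided by \<open>card A * D\<close>, with
    \<open>D = 2 ^ (s + t)\<close> from \<open>wdeg_w_le\<close>. It depends on \<open>s\<close> and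
    \<open>t\<close> only.\<close>
  define \<epsilon> where "\<epsilon> = 1 / (2 * real s ^ s * 2 ^ t * fact t * 2 ^ (s + t))"
  have \<epsilon>: "\<epsilon> > 0" using assms by (simp add: \<epsilon>_def)
  have st: "s * t = Suc (s * t - 1)" using assms by simp
  obtain \<delta> :: real where \<delta>: "\<delta> > 0" and cont: "\<forall>(V :: 'a set set) w (\<tau> :: real) (D :: real) (b :: nat).
     finite V \<longrightarrow> 0 < \<tau> \<longrightarrow> \<tau> \<le> 1 \<longrightarrow> 0 < D \<longrightarrow> \<tau> * card V \<le> real b \<longrightarrow> b > 0 \<longrightarrow>
     uniform_weight V (Suc (s * t - 1)) w \<longrightarrow> (\<forall>X. X \<noteq> {} \<longrightarrow> wdeg V w X \<le> D * \<tau> ^ (card X - 1)) \<longrightarrow>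
     \<epsilon> * card V * D \<le> wdeg V w {} \<longrightarrow>
     (\<exists>f. container_map (w_independent w) V ((1 - \<delta>) * real (card V)) ((s * t - 1) * b) f)"
    using weighted_container[OF \<epsilon>, of "s * t - 1"] by blast
  show ?thesis
  proof (intro exI[of _ \<delta>] conjI allI impI \<delta>)
    fix X :: "'a set" and A \<tau> and b :: nat
    assume "dense_graph X A s t"
    then interpret dense_graph X A s t .
    assume \<tau>: "0 < \<tau>" "\<tau> \<le> 1" "1 / d \<le> \<tau>" "1 / \<kappa> \<le> \<tau>" "1 / (d ^ (s - 1) * \<kappa> ^ (t - 1)) \<le> \<tau> ^ (s * t - 1)"
      and b: "\<tau> * card A \<le> real b"
    have "0 < \<tau> * card A" using \<tau> card_A by simp
    then have b0: "b > 0" using b by simp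
    have "\<exists>f. container_map (w_independent w) A ((1 - \<delta>) * real (card A)) ((s * t - 1) * b) f"
    proof (rule cont[rule_format, OF finite_A \<tau>(1,2) _ b b0])
      show "(0::real) < 2 ^ (s + t)" by simp
      show "uniform_weight A (Suc (s * t - 1)) w" using uniform_w st by simp
      show "wdeg A w X \<le> 2 ^ (s + t) * \<tau> ^ (card X - 1)" if "X \<noteq> {}" for X
        using wdeg_w_le[OF \<tau> that] .
      show "\<epsilon> * card A * 2 ^ (s + t) \<le> wdeg A w {}" using wdeg_w_empty by (simp add: \<epsilon>_def mult_ac)
    qed
    then obtain f where f: "container_map (w_independent w) A ((1 - \<delta>) * real (card A)) ((s * t - 1) * b) f"
      by blast
    have ind: "w_independent w I" if "bipfree s t I" for I
      unfolding w_independent_def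
    proof (intro allI impI notI)
      fix E assume E: "w E \<noteq> 0" "E \<subseteq> I"
      from E(1) obtain S T where "(S, T) \<in> copies" "E = biclique S T" by (rule w_nonzeroD)
      then show False using copiesD[of S T] that E by (auto simp: bipfree_def)
    qed
    have le: "(s * t - 1) * b \<le> s * t * b" by simp
    show "\<exists>f. container_map (bipfree s t) A ((1 - \<delta>) * real (card A)) (s * t * b) f"
      using container_map_mono[OF f, of "bipfree s t"] ind le by blast
  qed
qed

text \<open>This is \<open>\<tau> |A|\<close> for the \<open>\<tau>\<close> with \<open>\<tau>^(st-1) = 1 / (d^(s-1) \<kappa>^(t-1))\<close>, which does not depend
  on \<open>|A|\<close>.\<close>

definition critical_term :: "nat \<Rightarrow> nat \<Rightarrow> nat \<Rightarrow> real" where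
  "critical_term s t n = n * root (s * t - 1) ((2 * real s ^ s * real n ^ (s - 1)) ^ (t - 1))"

lemma critical_term_nonneg: "0 \<le> critical_term s t n"
  unfolding critical_term_def by (intro mult_nonneg_nonneg real_root_ge_zero zero_le_power) auto

text \<open>The main cost is the fingerprint size, about \<open>s * t * \<tau> * card A\<close>,
  times a price \<open>ln (q * \<kappa>)\<close> per element. With \<open>\<tau>\<close> the maximum
  of the two critical values, \<open>\<tau> * card A\<close> is at most
  \<open>card A / \<kappa>\<close> plus \<open>critical_term\<close>.\<close>

lemma free_sum_step:
  assumes st: "2 \<le> s" "2 \<le> t"
  shows "\<exists>\<delta>. 0 < \<delta> \<and> \<delta> < 1 \<and> (\<forall>(X :: 'a set) A q B. dense_graph X A s t \<longrightarrow> 0 < q \<longrightarrow>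
     1 \<le> q * dense_graph.\<kappa> X A s \<longrightarrow> 0 \<le> B \<longrightarrow>
     (\<forall>A'\<subseteq>A. real (card A') \<le> (1 - \<delta>) * real (card A) \<longrightarrow> free_sum s t q A' \<le> B) \<longrightarrow>
     free_sum s t q A \<le> exp (2 * real (s * t) * (card A / dense_graph.\<kappa> X A s + critical_term s t (card X))
        * (1 + ln (q * dense_graph.\<kappa> X A s))) * B)"
proof -
  obtain \<delta>0 :: real where \<delta>0: "\<delta>0 > 0" and cont: "\<forall>(X :: 'a set) A \<tau> b. dense_graph X A s t \<longrightarrow> 0 < \<tau> \<longrightarrow> \<tau> \<le> 1 \<longrightarrow>
     1 / dense_graph.d X A \<le> \<tau> \<longrightarrow> 1 / dense_graph.\<kappa> X A s \<le> \<tau> \<longrightarrow>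
     1 / (dense_graph.d X A ^ (s - 1) * dense_graph.\<kappa> X A s ^ (t - 1)) \<le> \<tau> ^ (s * t - 1) \<longrightarrow>
     \<tau> * card A \<le> real b \<longrightarrow>
     (\<exists>f. container_map (bipfree s t) A ((1 - \<delta>0) * real (card A)) (s * t * b) f)"
    using biclique_container[OF st] by blast
  \<comment> \<open>Kept below 1 because the recursion divides by \<open>sqrt (1 - \<delta>)\<close>
    and takes its logarithm.\<close>
  define \<delta> where "\<delta> = min \<delta>0 (1/2)"
  have \<delta>: "0 < \<delta>" "\<delta> < 1" "\<delta> \<le> \<delta>0" using \<delta>0 by (auto simp: \<delta>_def)
  show ?thesis
  proof (intro exI[of _ \<delta>] conjI allI impI \<delta>(1,2))
    fix X :: "'a set" and A and q B :: real
    assume dg: "dense_graph X A s t"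
    then interpret dense_graph X A s t .
    assume q: "0 < q" "1 \<le> q * \<kappa>" and B: "0 \<le> B"
      and sub: "\<forall>A'\<subseteq>A. real (card A') \<le> (1 - \<delta>) * real (card A) \<longrightarrow> free_sum s t q A' \<le> B"
    define n where "n = real (card X)"
    define M where "M = real (card A)"
    define \<eta> where "\<eta> = (2 * real s ^ s * n ^ (s - 1)) ^ (t - 1)"
    define \<tau>\<^sub>1 where "\<tau>\<^sub>1 = root (s * t - 1) \<eta> / d"
    define \<tau> where "\<tau> = max (1 / \<kappa>) \<tau>\<^sub>1"
    have n: "n > 0" using card_X by (simp add: n_def)
    have M: "M > 0" using card_A by (simp add: M_def)
    have st1: "s * t - 1 > 0" using st mult_le_mono[of 2 s 2 t] by simp
    have \<eta>: "\<eta> > 0" using n st by (simp add: \<eta>_def)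
    have \<kappa>_eq: "\<kappa> = d ^ s / (2 * real s ^ s * n ^ (s - 1))"
    proof -
      have "2 * s - 1 = s + (s - 1)" using st by simp
      then have "n ^ (2 * s - 1) = n ^ s * n ^ (s - 1)" by (simp add: power_add)
      then show ?thesis using n by (simp add: \<kappa>_def d_def n_def[symmetric] power_divide)
    qed
    \<comment> \<open>Since \<open>\<kappa> ^ (t - 1) = d ^ (s * (t - 1)) / \<eta>\<close> and
      \<open>(s - 1) + s * (t - 1) = s * t - 1\<close>, only a power of \<open>d\<close> and
      \<open>\<eta>\<close> remain.\<close>
    have \<tau>1_pow: "\<tau>\<^sub>1 ^ (s * t - 1) = 1 / (d ^ (s - 1) * \<kappa> ^ (t - 1))"
    proof -
      have "\<tau>\<^sub>1 ^ (s * t - 1) = \<eta> / d ^ (s * t - 1)"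
        unfolding \<tau>\<^sub>1_def using \<eta> st1 by (simp add: power_divide real_root_pow_pos2)
      moreover have "\<kappa> ^ (t - 1) = d ^ (s * (t - 1)) / \<eta>"
        unfolding \<kappa>_eq \<eta>_def by (simp add: power_divide power_mult)
      moreover have "s * t - 1 = (s - 1) + s * (t - 1)"
        using st by (cases t) (auto simp: algebra_simps)
      ultimately show ?thesis using d_pos \<eta> by (simp add: power_add)
    qed
    have d1: "1 \<le> d" using d_ge st by linarith
    have \<kappa>1: "1 \<le> \<kappa>" using kappa_ge st by linarith
    have \<tau>1_pos: "0 < \<tau>\<^sub>1" using \<eta> st1 d_pos by (simp add: \<tau>\<^sub>1_def)
    have "\<tau>\<^sub>1 ^ (s * t - 1) \<le> 1"
      unfolding \<tau>1_pow using d1 \<kappa>1 mult_mono[of 1 "d ^ (s - 1)" 1 "\<kappa> ^ (t - 1)"]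
      by (simp add: one_le_power divide_le_eq)
    then have \<tau>1_le: "\<tau>\<^sub>1 \<le> 1" using \<tau>1_pos st1 by (simp add: power_le_one_iff)
    have dn: "d \<le> n"
    proof -
      have "card A \<le> card X * card X"
        using card_mono[OF finite_all_pairs[OF finite_X] A] card_all_pairs_le[OF finite_X]
        by (simp add: power2_eq_square)
      then have "real (card A) \<le> real (card X) * real (card X)" by (metis of_nat_le_iff of_nat_mult)
      then show ?thesis using n by (simp add: d_def n_def divide_le_eq)
    qed
    \<comment> \<open>Thus the constraint \<open>1 / d \<le> \<tau>\<close> is implied by
      \<open>1 / \<kappa> \<le> \<tau>\<close>.\<close>
    have \<kappa>d: "\<kappa> \<le> d"
    proof -
      have "1 \<le> real s ^ s" using st by (intro one_le_power) auto
      then have s1: "1 \<le> 2 * real s ^ s" by linarith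
      have "d ^ s = d * d ^ (s - 1)" using st by (metis Suc_diff_1 less_le_trans pos2 power_Suc)
      also have "\<dots> \<le> d * n ^ (s - 1)" using dn d_pos by (intro mult_left_mono power_mono) auto
      also have "\<dots> \<le> d * (2 * real s ^ s * n ^ (s - 1))"
        using d_pos n s1 by (intro mult_left_mono) (auto simp: mult_le_cancel_right1)
      finally show ?thesis using n st by (simp add: \<kappa>_eq divide_le_eq)
    qed
    have \<tau>: "0 < \<tau>" "\<tau> \<le> 1" "1 / \<kappa> \<le> \<tau>" using \<tau>1_pos \<tau>1_le \<kappa>1 by (auto simp: \<tau>_def)
    have \<tau>d: "1 / d \<le> \<tau>"
      using \<tau>(3) divide_left_mono[OF \<kappa>d, of 1] kappa_pos d_pos by simp
    have \<tau>3: "1 / (d ^ (s - 1) * \<kappa> ^ (t - 1)) \<le> \<tau> ^ (s * t - 1)"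
      unfolding \<tau>1_pow[symmetric] using \<tau>1_pos by (intro power_mono) (auto simp: \<tau>_def)
    have G1: "1 \<le> M / \<kappa>"
    proof -
      have "d \<le> M" using n card_X M by (simp add: d_def M_def n_def divide_le_eq)
      then have "\<kappa> \<le> M" using \<kappa>d by simp
      then show ?thesis using kappa_pos by simp
    qed
    define b where "b = nat \<lceil>\<tau> * M\<rceil>"
    have b: "\<tau> * M \<le> real b" unfolding b_def by linarith
    \<comment> \<open>Rounding \<open>\<tau> * M\<close> up then costs at most a factor 2.\<close>
    have \<tau>M1: "1 \<le> \<tau> * M"
    proof -
      have "M / \<kappa> \<le> \<tau> * M" using \<tau>(3) M mult_right_mono[of "1 / \<kappa>" \<tau> M] by simp
      then show ?thesis using G1 by linarith
    qed
    have b2: "real b \<le> 2 * (\<tau> * M)" unfolding b_def using \<tau>M1 by linarith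
    obtain g where g: "container_map (bipfree s t) A ((1 - \<delta>0) * real (card A)) (s * t * b) g"
      using cont[rule_format, OF dg \<tau>(1,2) \<tau>d \<tau>(3) \<tau>3 b[unfolded M_def]] by blast
    have le\<delta>: "(1 - \<delta>0) * real (card A) \<le> (1 - \<delta>) * real (card A)"
      using \<delta> by (intro mult_right_mono) auto
    \<comment> \<open>This makes \<open>q * \<theta> * card A\<close> equal to
      \<open>M / \<kappa>\<close>, no larger than \<open>\<tau> * M\<close>, while each fingerprint
      element costs only \<open>ln (q * \<kappa>)\<close>.\<close>
    define \<theta> where "\<theta> = 1 / (q * \<kappa>)"
    have \<theta>: "0 < \<theta>" "\<theta> \<le> 1" using q kappa_pos by (auto simp: \<theta>_def)
    have "free_sum s t q A \<le> (\<Sum>T | T \<subseteq> A \<and> card T \<le> s * t * b. q ^ card T) * B"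
    proof (rule free_sum_container[OF finite_A q(1), where c = "(1 - \<delta>) * real (card A)"])
      show "container_map (bipfree s t) A ((1 - \<delta>) * real (card A)) (s * t * b) g"
        using container_map_mono[OF g _ le\<delta>, of "bipfree s t" "s * t * b"] by blast
    qed (use \<delta> sub in auto)
    also have "\<dots> \<le> exp (q * \<theta> * card A) / \<theta> ^ (s * t * b) * B"
      using finite_A q \<theta> B by (intro mult_right_mono sum_small_subsets_le) auto
    also have "exp (q * \<theta> * card A) / \<theta> ^ (s * t * b) = exp (M / \<kappa> + real (s * t) * real b * ln (q * \<kappa>))"
    proof -
      have "1 / \<theta> ^ (s * t * b) = (q * \<kappa>) ^ (s * t * b)" by (simp add: \<theta>_def power_divide)
      also have "\<dots> = exp (real (s * t * b) * ln (q * \<kappa>))" unfolding exp_of_nat_mult using q kappa_pos by simp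
      finally have "1 / \<theta> ^ (s * t * b) = exp (real (s * t) * real b * ln (q * \<kappa>))" by simp
      moreover have "q * \<theta> * card A = M / \<kappa>" using q by (simp add: \<theta>_def M_def)
      ultimately show ?thesis by (metis exp_add mult.right_neutral times_divide_eq_right)
    qed
    also have "M / \<kappa> + real (s * t) * real b * ln (q * \<kappa>)
        \<le> 2 * real (s * t) * (M / \<kappa> + critical_term s t (card X)) * (1 + ln (q * \<kappa>))"
    proof -
      have ln0: "0 \<le> ln (q * \<kappa>)" using q by simp
      have \<tau>M: "\<tau> * M \<le> M / \<kappa> + critical_term s t (card X)"
      proof -
        have "\<tau>\<^sub>1 * M = critical_term s t (card X)"
          using M n by (simp add: \<tau>\<^sub>1_def critical_term_def d_def M_def n_def \<eta>_def)
        moreover have "\<tau> \<le> 1 / \<kappa> + \<tau>\<^sub>1" using \<tau>1_pos kappa_pos by (auto simp: \<tau>_def)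
        then have "\<tau> * M \<le> (1 / \<kappa> + \<tau>\<^sub>1) * M" using M by (intro mult_right_mono) auto
        ultimately show ?thesis by (simp add: distrib_right)
      qed
      have fp0: "0 \<le> critical_term s t (card X)" by (rule critical_term_nonneg)
      have st2: "1 \<le> 2 * real (s * t)" using st1 by (simp flip: of_nat_mult)
      have "real (s * t) * real b * ln (q * \<kappa>) \<le> real (s * t) * (2 * (M / \<kappa> + critical_term s t (card X))) * ln (q * \<kappa>)"
        using b2 \<tau>M ln0 by (intro mult_right_mono mult_left_mono) auto
      moreover have "1 * (M / \<kappa>) \<le> 2 * real (s * t) * (M / \<kappa> + critical_term s t (card X))"
        using st2 G1 fp0 by (intro mult_mono) auto
      moreover have "2 * k * g * (1 + l) = 2 * k * g + k * (2 * g) * l" for k g l :: real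
        by (simp add: algebra_simps)
      ultimately show ?thesis by (metis add_mono mult_1)
    qed
    finally show "free_sum s t q A \<le> exp (2 * real (s * t) * (card A / \<kappa> + critical_term s t (card X))
        * (1 + ln (q * \<kappa>))) * B" using B by (simp add: M_def mult_right_mono)
  qed
qed

text \<open>Induction with a potential in \<open>y = |A| / K\<close> that drops by exactly the cost
  \<open>a / sqrt y + h\<close> when \<open>y\<close> is multiplied by \<open>1 - \<delta>\<close>.\<close>

lemma geometric_recursion:
  fixes Z :: "'a set \<Rightarrow> real" and K q a h \<delta> :: real
  assumes V: "finite V" and K: "0 < K" and q: "0 \<le> q" and ah: "0 \<le> a" "0 \<le> h" and \<delta>: "0 < \<delta>" "\<delta> < 1"
    and small: "\<And>A. A \<subseteq> V \<Longrightarrow> Z A \<le> exp (q * card A)"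
    and step: "\<And>A B. A \<subseteq> V \<Longrightarrow> K < card A \<Longrightarrow> 0 \<le> B \<Longrightarrow>
      (\<And>A'. A' \<subseteq> A \<Longrightarrow> real (card A') \<le> (1 - \<delta>) * card A \<Longrightarrow> Z A' \<le> B) \<Longrightarrow>
      Z A \<le> exp (a / sqrt (card A / K) + h) * B"
  shows "A \<subseteq> V \<Longrightarrow> Z A \<le> exp (q * K
      + a / (1 / sqrt (1 - \<delta>) - 1) * (1 / sqrt (1 - \<delta>) - 1 / sqrt (max (card A / K) (1 - \<delta>)))
      + h / - ln (1 - \<delta>) * (ln (max (card A / K) (1 - \<delta>)) - ln (1 - \<delta>)))"
proof (induction "card A" arbitrary: A rule: less_induct)
  case less
  define r where "r = 1 - \<delta>"
  have r: "0 < r" "r < 1" using \<delta> by (auto simp: r_def)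
  have c1: "0 < 1 / sqrt r - 1" and c2: "0 < - ln r" using r by auto
  define \<Phi> where "\<Phi> z = a / (1 / sqrt r - 1) * (1 / sqrt r - 1 / sqrt z) + h / - ln r * (ln z - ln r)" for z
  have mono: "\<Phi> x \<le> \<Phi> y" if "0 < x" "x \<le> y" for x y
    unfolding \<Phi>_def using that ah c1 c2 r
    by (intro add_mono mult_left_mono divide_nonneg_pos diff_mono divide_left_mono mult_pos_pos) auto
  \<comment> \<open>The potential vanishes at \<open>r\<close>. Clipping there is harmless: a step
    starts at some \<open>y > 1\<close>, and the induction hypothesis is used with the bound
    \<open>r * y > r\<close>.\<close>
  have \<Phi>0: "0 \<le> \<Phi> x" if "r \<le> x" for x
    using mono[of r x] that r by (simp add: \<Phi>_def)
  define y where "y = card A / K"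
  have "Z A \<le> exp (q * K + \<Phi> (max y r))"
  proof (cases "real (card A) \<le> K")
    case True
    have "q * card A \<le> q * K + \<Phi> (max y r)"
      using \<Phi>0[of "max y r"] mult_left_mono[OF True q] by simp
    then show ?thesis using small[OF less.prems] by (meson exp_le_cancel_iff order_trans)
  next
    case False
    then have y: "1 < y" using K by (simp add: y_def)
    have ry: "r < r * y" using r y by simp
    have "Z A \<le> exp (a / sqrt (card A / K) + h) * exp (q * K + \<Phi> (r * y))"
    proof (rule step[OF less.prems])
      fix A' assume A': "A' \<subseteq> A" "real (card A') \<le> (1 - \<delta>) * card A"
      have "(1 - \<delta>) * real (card A) < 1 * real (card A)" using \<delta> False K by (intro mult_strict_right_mono) auto
      then have "card A' < card A" using A' by linarith
      moreover have "A' \<subseteq> V" using A' less.prems by auto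
      ultimately have "Z A' \<le> exp (q * K + \<Phi> (max (card A' / K) r))"
        using less.hyps[of A'] unfolding \<Phi>_def r_def add.assoc by blast
      moreover have "card A' / K \<le> r * y"
        using A' K by (simp add: y_def r_def divide_right_mono)
      then have "\<Phi> (max (card A' / K) r) \<le> \<Phi> (r * y)"
        using ry r by (intro mono) auto
      ultimately show "Z A' \<le> exp (q * K + \<Phi> (r * y))"
        by (meson add_left_mono exp_le_cancel_iff order_trans)
    qed (use False in auto)
    also have "\<dots> = exp (q * K + (a / sqrt y + h + \<Phi> (r * y)))" by (simp add: y_def exp_add[symmetric] ac_simps)
    also have "a / sqrt y + h + \<Phi> (r * y) = \<Phi> y"
    proof -
      have "h / - ln r * (ln y - ln r) = h / - ln r * (ln (r * y) - ln r) + h"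
        using c2 r y by (simp add: ln_mult field_simps)
      moreover have "a / (1 / sqrt r - 1) * (1 / sqrt r - 1 / sqrt y)
          = a / (1 / sqrt r - 1) * (1 / sqrt r - 1 / sqrt (r * y)) + a / sqrt y"
      proof -
        have "1 / sqrt (r * y) = (1 / sqrt r - 1) * (1 / sqrt y) + 1 / sqrt y"
          by (simp add: real_sqrt_mult diff_divide_distrib)
        then have "a / (1 / sqrt r - 1) * (1 / sqrt r - 1 / sqrt (r * y))
           = a / (1 / sqrt r - 1) * (1 / sqrt r - 1 / sqrt y) - a / (1 / sqrt r - 1) * ((1 / sqrt r - 1) * (1 / sqrt y))"
          by (simp add: algebra_simps)
        also have "a / (1 / sqrt r - 1) * ((1 / sqrt r - 1) * (1 / sqrt y)) = a / sqrt y"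
          using c1 by (metis less_irrefl mult.assoc mult.right_neutral nonzero_divide_eq_eq times_divide_eq_right)
        finally show ?thesis by simp
      qed
      ultimately show ?thesis unfolding \<Phi>_def by linarith
    qed
    also have "\<Phi> y = \<Phi> (max y r)" using y r by (simp add: max_def)
    finally show ?thesis by simp
  qed
  then show ?case unfolding \<Phi>_def r_def y_def add.assoc .
qed

section \<open>The choice of K and the total cost\<close>

lemma critical_term_le:
  assumes st: "2 \<le> s" "2 \<le> t" and n: "1 \<le> n"
  shows "critical_term s t n \<le> 2 * real s ^ s * real n powr (2 - (real s + real t - 2) / (real s * real t - 1))"
proof -
  define N where "N = real s * real t - 1"
  have st4: "4 \<le> s * t" using st mult_le_mono[of 2 s 2 t] by simp
  have "real (s * t - 1) = real (s * t) - real 1" by (rule of_nat_diff) (use st4 in linarith)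
  then have N_eq: "real (s * t - 1) = N" by (simp add: N_def)
  have N: "N > 0" using st4 unfolding N_eq[symmetric] by simp
  define c where "c = 2 * real s ^ s"
  have "1 \<le> real s ^ s" using st by (intro one_le_power) auto
  then have c: "1 \<le> c" by (simp add: c_def)
  have pos: "0 < c * real n ^ (s - 1)" using c n by simp
  have "root (s * t - 1) ((c * real n ^ (s - 1)) ^ (t - 1)) = (c * real n ^ (s - 1)) powr ((real t - 1) / N)"
    using pos st st4 by (simp add: root_powr_inverse powr_realpow[symmetric] powr_powr N_eq[symmetric] of_nat_diff divide_inverse)
  also have "\<dots> = c powr ((real t - 1) / N) * real n powr ((real s - 1) * (real t - 1) / N)"
    using c n st by (simp add: powr_mult powr_realpow[symmetric] powr_powr of_nat_diff)
  also have "\<dots> \<le> c powr 1 * real n powr ((real s - 1) * (real t - 1) / N)"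
  proof (intro mult_right_mono powr_mono)
    have "real t \<le> real s * real t" using st by simp
    then show "(real t - 1) / N \<le> 1" using N by (simp add: N_def)
  qed (use c in auto)
  finally have "critical_term s t n \<le> c * (n * real n powr ((real s - 1) * (real t - 1) / N))"
    using c n mult_left_mono by (fastforce simp: critical_term_def c_def)
  also have "n * real n powr ((real s - 1) * (real t - 1) / N) = real n powr (1 + (real s - 1) * (real t - 1) / N)"
    using n by (simp add: powr_add)
  \<comment> \<open>This is \<open>(s - 1) * (t - 1) + (s + t - 2) = s * t - 1\<close>.\<close>
  also have "1 + (real s - 1) * (real t - 1) / N = 2 - (real s + real t - 2) / N"
    using N by (simp add: N_def field_simps)
  finally show ?thesis by (simp add: c_def N_def)
qed

lemma free_sum_bound:
  assumes st: "2 \<le> s" "2 \<le> t"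
  shows "\<exists>C>0. \<forall>(X :: 'a set) p. finite X \<longrightarrow> 3 \<le> card X \<longrightarrow> 0 < p \<longrightarrow> p \<le> 1 \<longrightarrow>
    free_sum s t (exp 1 * p) (all_pairs X) \<le> exp (C *
      (p powr ((real s - 1) / real s) * real (card X) powr (2 - 1 / real s)
       + real (card X) powr (2 - (real s + real t - 2) / (real s * real t - 1)) * (ln (real (card X)))\<^sup>2))"
proof -
  obtain \<delta> where \<delta>: "0 < \<delta>" "\<delta> < 1" and step: "\<forall>(X :: 'a set) A q B. dense_graph X A s t \<longrightarrow> 0 < q \<longrightarrow>
     1 \<le> q * dense_graph.\<kappa> X A s \<longrightarrow> 0 \<le> B \<longrightarrow>
     (\<forall>A'\<subseteq>A. real (card A') \<le> (1 - \<delta>) * real (card A) \<longrightarrow> free_sum s t q A' \<le> B) \<longrightarrow>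
     free_sum s t q A \<le> exp (2 * real (s * t) * (card A / dense_graph.\<kappa> X A s + critical_term s t (card X))
        * (1 + ln (q * dense_graph.\<kappa> X A s))) * B"
    using free_sum_step[OF st] by blast
  define r where "r = 1 - \<delta>"
  have r: "0 < r" "r < 1" using \<delta> by (auto simp: r_def)
  have c1: "0 < 1 / sqrt r - 1" and c2: "0 < - ln r" using r by auto
  \<comment> \<open>The numerator comes from
    \<open>1 + ln (q * \<kappa>) = 2 + ln (2 * t) + s * ln y\<close> and
    \<open>ln y \<le> 2 * sqrt y\<close>, the denominator from the bound on
    \<open>M / \<kappa>\<close>.\<close>
  define C1 where "C1 = (2 + ln (2 * real t) + 2 * real s) / (2 * real t)"
  have "0 \<le> ln (2 * real t)" using st by simp
  then have C1: "0 < C1" using st by (auto simp: C1_def intro!: divide_pos_pos add_nonneg_pos)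
  \<comment> \<open>\<open>c0 / (2 * s ^ s) = 2 * t\<close>, so \<open>\<kappa> = 2 * t / p\<close>
    when \<open>card A = K\<close>. Above \<open>K\<close> this yields
    \<open>2 * t \<le> \<kappa>\<close> and \<open>1 \<le> q * \<kappa>\<close>, as
    \<open>free_sum_step\<close> needs.\<close>
  define c0 where "c0 = 4 * real t * real s ^ s"
  have "1 \<le> real s ^ s" using st by (intro one_le_power) auto
  then have c0: "1 \<le> c0" using st mult_mono[of 1 "4 * real t" 1 "real s ^ s"] by (simp add: c0_def)
  define c3 where "c3 = c0 powr (1 / s)"
  have c3: "0 < c3" using c0 by (simp add: c3_def)
  \<comment> \<open>The first summand pays for the trivial bound at size \<open>K\<close>, the
    second for the geometric series.\<close>
  define Ca where "Ca = exp 1 * c3 + 2 * real (s * t) * C1 * c3 / (1 / sqrt r - 1) * (1 / sqrt r)"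
  \<comment> \<open>Here \<open>2 * s ^ s\<close> is from \<open>critical_term_le\<close>,
    \<open>3\<close> from \<open>2 + ln n \<le> 3 * ln n\<close>, and
    \<open>(2 - ln r) / - ln r\<close> from the number of steps.\<close>
  define Cb where "Cb = 2 * real (s * t) * (2 * real s ^ s) * 3 / - ln r * (2 - ln r)"
  have Ca: "0 < Ca" unfolding Ca_def using c3 C1 c1 r by (intro add_pos_nonneg) auto
  have Cb: "0 < Cb" unfolding Cb_def using c2 st by (intro mult_pos_pos divide_pos_pos) auto
  have main: "free_sum s t (exp 1 * p) (all_pairs X) \<le> exp (Ca *
      (p powr ((real s - 1) / real s) * real (card X) powr (2 - 1 / real s))
       + Cb * (real (card X) powr (2 - (real s + real t - 2) / (real s * real t - 1)) * (ln (real (card X)))\<^sup>2))"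
    if X: "finite X" "3 \<le> card X" and p: "0 < p" "p \<le> 1" for X :: "'a set" and p :: real
  proof -
    define n where "n = real (card X)"
    define K where "K = (c0 * n ^ (2 * s - 1) / p) powr (1 / s)"
    define q where "q = exp 1 * p"
    define fp where "fp = critical_term s t (card X)"
    define a where "a = 2 * real (s * t) * C1 * (K * p)"
    define h where "h = 2 * real (s * t) * fp * (2 + ln n)"
    have n: "3 \<le> n" using X by (simp add: n_def)
    have q: "0 < q" using p by (simp add: q_def)
    have ln_n: "1 \<le> ln n"
    proof -
      have "exp 1 \<le> n" using n e_less_272 by linarith
      then show ?thesis using n by (subst ln_ge_iff) auto
    qed
    have base: "0 < c0 * n ^ (2 * s - 1) / p" using c0 n p by simp
    have K: "0 < K" using base unfolding K_def by (metis less_irrefl powr_gt_zero)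
    have K_pow: "K ^ s = c0 * n ^ (2 * s - 1) / p"
    proof -
      have "K ^ s = K powr real s" using K by (simp add: powr_realpow)
      also have "\<dots> = (c0 * n ^ (2 * s - 1) / p) powr (1 / s * s)" unfolding K_def by (rule powr_powr)
      also have "1 / real s * real s = 1" using st by simp
      also have "(c0 * n ^ (2 * s - 1) / p) powr 1 = c0 * n ^ (2 * s - 1) / p"
        using base by (intro powr_one) simp
      finally show ?thesis .
    qed
    have "1 * 1 \<le> c0 * n ^ (2 * s - 1)" using c0 n by (intro mult_mono one_le_power) auto
    also have "\<dots> \<le> K ^ s" unfolding K_pow using c0 n p by (simp add: le_divide_eq mult_left_le)
    finally have "1 \<le> K ^ s" by simp
    then have K1: "1 \<le> K" using power_strict_mono[of K 1 s] K st by force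
    have fp: "0 \<le> fp" by (simp add: fp_def critical_term_nonneg)
    have a: "0 \<le> a" using C1 K p by (simp add: a_def)
    have h: "0 \<le> h" using fp ln_n by (simp add: h_def)
    have finV: "finite (all_pairs X)" using X by (simp add: finite_all_pairs)
    have fin_sub: "finite A" if "A \<subseteq> all_pairs X" for A using that finV by (rule finite_subset)
    have cardV: "real (card (all_pairs X)) \<le> n ^ 2"
      using card_all_pairs_le[OF X(1)] unfolding n_def by (metis of_nat_le_iff of_nat_power)
    have step': "free_sum s t q A \<le> exp (a / sqrt (card A / K) + h) * B"
      if A: "A \<subseteq> all_pairs X" "K < card A" and B: "0 \<le> B"
        and sub: "\<And>A'. A' \<subseteq> A \<Longrightarrow> real (card A') \<le> (1 - \<delta>) * card A \<Longrightarrow> free_sum s t q A' \<le> B" for A B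
    proof -
      define M where "M = real (card A)"
      define y where "y = M / K"
      have y: "1 < y" using A K by (simp add: y_def M_def)
      have M: "0 < M" using A K by (simp add: M_def)
      have Mn: "M \<le> n ^ 2" using card_mono[OF finV A(1)] cardV by (simp add: M_def)
      have KM: "c0 * n ^ (2 * s - 1) / p \<le> M ^ s"
        unfolding K_pow[symmetric] using A K by (intro power_mono) (auto simp: M_def)
      have cn: "0 \<le> c0 * n ^ (2 * s - 1)" using c0 n by simp
      have KM': "c0 * n ^ (2 * s - 1) \<le> M ^ s"
        using KM cn p by (meson le_divide_eq_1_pos mult_left_le divide_left_mono order_trans le_divide_eq)
      have dg: "dense_graph X A s t"
      proof
        show "2 * real t * (2 * real s ^ s * real (card X) ^ (2 * s - 1)) \<le> real (card A) ^ s"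
          using KM' by (simp add: c0_def n_def M_def mult_ac)
        have "(s * n) ^ s = real s ^ s * n ^ s" by (simp add: power_mult_distrib)
        also have "\<dots> \<le> c0 * n ^ (2 * s - 1)"
          using n st by (intro mult_mono power_increasing) (auto simp: c0_def)
        finally have "(s * n) ^ s \<le> M ^ s" using KM' by simp
        then show "real s * real (card X) \<le> real (card A)"
          using M st by (simp add: n_def M_def)
        show "A \<noteq> {}" using M by (auto simp: M_def)
      qed (use X A st in auto)
      interpret dense_graph X A s t by (rule dg)
      have \<kappa>: "\<kappa> = 2 * real t / p * y ^ s"
        unfolding \<kappa>_def y_def power_divide K_pow using n p st
        by (simp add: c0_def n_def M_def)
      have q\<kappa>: "q * \<kappa> = 2 * real t * exp 1 * y ^ s" using p by (simp add: \<kappa> q_def)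
      have ys: "1 \<le> y ^ s" using y by (intro one_le_power) auto
      have q\<kappa>1: "1 \<le> q * \<kappa>"
      proof -
        have "1 * 1 * 1 \<le> 2 * real t * exp 1 * y ^ s" using ys st by (intro mult_mono) auto
        then show ?thesis by (simp add: q\<kappa>)
      qed
      \<comment> \<open>The logarithm may grow like \<open>sqrt y\<close>: the factor
        \<open>1 / y\<close> gained in \<open>G\<close> still leaves the summable
        \<open>1 / sqrt y\<close>.\<close>
      have ln1: "1 + ln (q * \<kappa>) \<le> (2 + ln (2 * real t) + 2 * real s) * sqrt y"
      proof -
        have "ln (q * \<kappa>) = ln (2 * real t) + 1 + s * ln y"
          unfolding q\<kappa> using y st by (simp add: ln_mult ln_realpow)
        moreover have "ln y \<le> 2 * sqrt y"
          using ln_le_minus_one[of "sqrt y"] y by (simp add: ln_sqrt)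
        then have "s * ln y \<le> s * (2 * sqrt y)" by (intro mult_left_mono) auto
        moreover have "(2 + ln (2 * real t)) * 1 \<le> (2 + ln (2 * real t)) * sqrt y"
          using \<open>0 \<le> ln (2 * real t)\<close> y by (intro mult_left_mono) auto
        ultimately show ?thesis by (simp add: algebra_simps)
      qed
      \<comment> \<open>The only use of \<open>s \<ge> 2\<close> in the summation:
        \<open>y / y ^ s \<le> 1 / y\<close>.\<close>
      have G: "M / \<kappa> \<le> K * p / (2 * real t) / y"
      proof -
        have "y * y \<le> y ^ s" using power_increasing[of 2 s y] st y by (simp add: power2_eq_square)
        then have "y / y ^ s \<le> 1 / y" using y ys by (simp add: field_simps)
        moreover have "M / \<kappa> = K * p / (2 * real t) * (y / y ^ s)"
          using K p st by (simp add: \<kappa> y_def field_simps)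
        ultimately show ?thesis using K p mult_left_mono[of "y / y ^ s" "1 / y" "K * p / (2 * real t)"] by simp
      qed
      have part1: "M / \<kappa> * (1 + ln (q * \<kappa>)) \<le> C1 * (K * p) / sqrt y"
      proof -
        have "M / \<kappa> * (1 + ln (q * \<kappa>)) \<le> K * p / (2 * real t) / y * ((2 + ln (2 * real t) + 2 * real s) * sqrt y)"
          using G ln1 q\<kappa>1 K p y by (intro mult_mono) auto
        also have "\<dots> = C1 * (K * p) * (sqrt y / y)" by (simp add: C1_def)
        also have "sqrt y / y = 1 / sqrt y" using y by (simp add: field_simps)
        finally show ?thesis by simp
      qed
      \<comment> \<open>The critical term does not shrink with \<open>y\<close>, so its logarithm is
        bounded uniformly, by \<open>\<kappa> \<le> n\<close>.\<close>
      have part2: "1 + ln (q * \<kappa>) \<le> 2 + ln n"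
      proof -
        have "M ^ s \<le> (n ^ 2) ^ s" using Mn M by (intro power_mono) auto
        also have "\<dots> = n * n ^ (2 * s - 1)"
          using st by (metis Suc_diff_1 less_le_trans mult_pos_pos pos2 power_Suc power_mult)
        also have "\<dots> \<le> n * (2 * real s ^ s * n ^ (2 * s - 1))"
          using n \<open>1 \<le> real s ^ s\<close> by (intro mult_left_mono) (auto simp: mult_le_cancel_right1)
        finally have "\<kappa> \<le> n" unfolding \<kappa>_def using n st by (simp add: M_def n_def divide_le_eq)
        then have "q * \<kappa> \<le> exp 1 * n" unfolding q_def using p kappa_pos n by (intro mult_mono) (auto simp: mult_left_le)
        then have "ln (q * \<kappa>) \<le> ln (exp 1 * n)" using q\<kappa>1 n by (subst ln_le_cancel_iff) auto
        then show ?thesis using n by (simp add: ln_mult)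
      qed
      have "free_sum s t q A \<le> exp (2 * real (s * t) * (M / \<kappa> + fp) * (1 + ln (q * \<kappa>))) * B"
        unfolding M_def fp_def using step[rule_format, OF dg q q\<kappa>1 B] sub by blast
      also have "\<dots> \<le> exp (a / sqrt y + h) * B"
      proof -
        have "(M / \<kappa> + fp) * (1 + ln (q * \<kappa>)) \<le> C1 * (K * p) / sqrt y + fp * (2 + ln n)"
          using part1 mult_left_mono[OF part2 fp] by (simp add: distrib_right)
        then have "2 * real (s * t) * ((M / \<kappa> + fp) * (1 + ln (q * \<kappa>)))
            \<le> 2 * real (s * t) * (C1 * (K * p) / sqrt y + fp * (2 + ln n))"
          by (intro mult_left_mono) auto
        also have "\<dots> = a / sqrt y + h" by (simp add: a_def h_def algebra_simps)
        finally show ?thesis using B by (intro mult_right_mono) (auto simp: mult.assoc)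
      qed
      finally show ?thesis by (simp add: y_def M_def)
    qed
    define z where "z = max (real (card (all_pairs X)) / K) r"
    have "free_sum s t q (all_pairs X) \<le> exp (q * K
      + a / (1 / sqrt r - 1) * (1 / sqrt r - 1 / sqrt z) + h / - ln r * (ln z - ln r))"
      unfolding z_def r_def
      by (rule geometric_recursion[OF finV K less_imp_le[OF q] a h \<delta>])
        (use step' free_sum_le_exp[OF fin_sub less_imp_le[OF q]] in auto)
    also have "\<dots> \<le> exp (Ca * (p powr ((real s - 1) / real s) * n powr (2 - 1 / real s))
       + Cb * (n powr (2 - (real s + real t - 2) / (real s * real t - 1)) * (ln n)\<^sup>2))"
    proof -
      have z: "r \<le> z" by (simp add: z_def)
      have Kp: "K * p = c3 * (p powr ((real s - 1) / real s) * n powr (2 - 1 / real s))"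
      proof -
        have e1: "K = c3 * n powr ((2 * real s - 1) / s) / p powr (1 / s)"
          unfolding K_def c3_def using c0 n p st
          by (simp add: powr_mult powr_divide powr_realpow[symmetric] powr_powr of_nat_diff)
        have e2: "(2 * real s - 1) / s = 2 - 1 / s" using st by (simp add: field_simps)
        have e3: "p / p powr (1 / s) = p powr ((real s - 1) / s)"
        proof -
          have "(real s - 1) / s = 1 - 1 / s" using st by (simp add: field_simps)
          then show ?thesis using p by (simp add: powr_diff)
        qed
        have "K * p = c3 * n powr (2 - 1 / s) * (p / p powr (1 / s))" unfolding e1 e2 by simp
        then show ?thesis unfolding e3 by (simp add: mult_ac)
      qed
      have 1: "q * K = exp 1 * (K * p)" by (simp add: q_def)
      have 2: "a / (1 / sqrt r - 1) * (1 / sqrt r - 1 / sqrt z) \<le> a / (1 / sqrt r - 1) * (1 / sqrt r)"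
        using a c1 z r by (intro mult_left_mono) auto
      have 3: "a / (1 / sqrt r - 1) * (1 / sqrt r) = 2 * real (s * t) * C1 / (1 / sqrt r - 1) * (1 / sqrt r) * (K * p)"
        by (simp add: a_def)
      have 12: "q * K + a / (1 / sqrt r - 1) * (1 / sqrt r - 1 / sqrt z)
          \<le> Ca * (p powr ((real s - 1) / real s) * n powr (2 - 1 / real s))"
      proof -
        have "q * K + a / (1 / sqrt r - 1) * (1 / sqrt r - 1 / sqrt z)
           \<le> (exp 1 + 2 * real (s * t) * C1 / (1 / sqrt r - 1) * (1 / sqrt r)) * (K * p)"
          unfolding distrib_right 1 using 2[unfolded 3] by (rule add_left_mono)
        also have "\<dots> = Ca * (p powr ((real s - 1) / real s) * n powr (2 - 1 / real s))"
          unfolding Kp Ca_def by (simp add: algebra_simps)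
        finally show ?thesis .
      qed
      have "ln z \<le> 2 * ln n"
      proof -
        have "real (card (all_pairs X)) / K \<le> n ^ 2"
          using cardV K1 K mult_mono[of "real (card (all_pairs X))" "n^2" 1 K] by (simp add: divide_le_eq)
        moreover have "r \<le> n ^ 2" using r n one_le_power[of n 2] by linarith
        ultimately have "z \<le> n ^ 2" by (simp add: z_def)
        then have "ln z \<le> ln (n ^ 2)" using z r n by (subst ln_le_cancel_iff) auto
        then show ?thesis using n by (simp add: ln_realpow)
      qed
      have lz: "ln z - ln r \<le> (2 - ln r) * ln n"
      proof -
        have "0 \<le> - ln r * (ln n - 1)" using ln_n c2 by (intro mult_nonneg_nonneg) auto
        then show ?thesis using \<open>ln z \<le> 2 * ln n\<close> by (simp add: algebra_simps)
      qed
      have "h \<le> 2 * real (s * t) * (2 * real s ^ s * n powr (2 - (real s + real t - 2) / (real s * real t - 1))) * (3 * ln n)"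
        unfolding h_def n_def fp_def using critical_term_le[OF st, of "card X"] X ln_n
        by (intro mult_mono) (auto simp: n_def critical_term_nonneg)
      then have h_le: "h / - ln r \<le> 2 * real (s * t) * (2 * real s ^ s * n powr (2 - (real s + real t - 2) / (real s * real t - 1))) * (3 * ln n) / - ln r"
        using c2 by (intro divide_right_mono) auto
      then have "h / - ln r * (ln z - ln r)
          \<le> 2 * real (s * t) * (2 * real s ^ s * n powr (2 - (real s + real t - 2) / (real s * real t - 1))) * (3 * ln n) / - ln r * ((2 - ln r) * ln n)"
      proof (rule mult_mono[OF _ lz])
        have "0 \<le> h / - ln r" using h c2 by (intro divide_nonneg_pos)
        then show "0 \<le> 2 * real (s * t) * (2 * real s ^ s * n powr (2 - (real s + real t - 2) / (real s * real t - 1))) * (3 * ln n) / - ln r"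
          using h_le by linarith
        show "0 \<le> ln z - ln r" using z r by simp
      qed
      also have "\<dots> = Cb * (n powr (2 - (real s + real t - 2) / (real s * real t - 1)) * (ln n)\<^sup>2)"
        by (simp add: Cb_def power2_eq_square)
      finally show ?thesis using 12 by (simp add: add.assoc)
    qed
    finally show ?thesis by (simp add: q_def n_def)
  qed
  show ?thesis
  proof (intro exI[of _ "max Ca Cb"] conjI allI impI)
    show "0 < max Ca Cb" using Ca by simp
    fix X :: "'a set" and p :: real
    assume X: "finite X" "3 \<le> card X" and p: "0 < p" "p \<le> 1"
    let ?P = "p powr ((real s - 1) / real s) * real (card X) powr (2 - 1 / real s)"
    let ?Q = "real (card X) powr (2 - (real s + real t - 2) / (real s * real t - 1)) * (ln (real (card X)))\<^sup>2"
    have "Ca * ?P \<le> max Ca Cb * ?P" "Cb * ?Q \<le> max Ca Cb * ?Q"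
      by (intro mult_right_mono; simp)+
    then have "Ca * ?P + Cb * ?Q \<le> max Ca Cb * (?P + ?Q)" by (simp add: distrib_left)
    then show "free_sum s t (exp 1 * p) (all_pairs X) \<le> exp (max Ca Cb * (?P + ?Q))"
      using main[OF X p] by (meson exp_le_cancel_iff order_trans)
  qed
qed

section \<open>Random graphs\<close>

text \<open>Bijections onto the two sides combine to an embedding. Both sides are nonempty, so each
  of their vertices lies on an edge and therefore in \<open>verts G\<close>.\<close>

lemma bipfree_edges:
  assumes G: "simple_graph G" and st: "1 \<le> s" "1 \<le> t"
    and free: "\<not> contains_copy G (complete_bipartite s t)"
  shows "bipfree s t (edges G)"
  unfolding bipfree_def
proof safe
  fix S T :: "'a set"
  assume s: "s = card S" and t: "t = card T" and dis: "S \<inter> T = {}" and sub: "biclique S T \<subseteq> edges G"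
  have fin: "finite S" "finite T" using st s t by (auto intro: card_ge_0_finite)
  obtain f g where f: "bij_betw f {..<s} S" and g: "bij_betw g {..<t} T"
    using fin s t by (metis finite_same_card_bij finite_lessThan card_lessThan)
  have mem: "{v, u} \<in> edges G" if "v \<in> S" "u \<in> T" for v u
    using sub that by (auto simp: biclique_def)
  have ne: "S \<noteq> {}" "T \<noteq> {}" using st s t by auto
  have "S \<union> T \<subseteq> verts G"
    using mem ne G unfolding simple_graph_def all_pairs_def by blast
  moreover have "case_sum f g ` verts (complete_bipartite s t) = S \<union> T"
    using f g by (auto simp: complete_bipartite_def image_Un image_image bij_betw_def)
  moreover have "f i \<noteq> g j \<and> g j \<noteq> f i" if "i < s" "j < t" for i j
    using f g dis that by (auto simp: bij_betw_def)
  then have "inj_on (case_sum f g) (verts (complete_bipartite s t))"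
    using f g by (auto simp: complete_bipartite_def inj_on_def bij_betw_def)
  moreover have "case_sum f g ` e \<in> edges G" if "e \<in> edges (complete_bipartite s t)" for e
    using that f g mem by (auto simp: complete_bipartite_def bij_betw_def)
  ultimately have "contains_copy G (complete_bipartite s t)"
    unfolding contains_copy_def by (intro exI[of _ "case_sum f g"]) auto
  then show False using free by simp
qed

lemma less_ex_numberE:
  assumes G: "simple_graph G" and st: "1 \<le> s" "1 \<le> t"
    and x: "x < real (ex_number G (complete_bipartite s t))"
  obtains I where "I \<subseteq> edges G" "bipfree s t I" "x < real (card I)"
proof -
  let ?N = "{card (edges G') |G'. is_subgraph G' G \<and> \<not> contains_copy G' (complete_bipartite s t)}"
  have finE: "finite (edges G)"
    using G by (auto simp: simple_graph_def all_pairs_def intro: finite_subset[of _ "Pow (verts G)"])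
  have "?N \<subseteq> {..card (edges G)}" using finE by (auto simp: is_subgraph_def intro: card_mono)
  then have "finite ?N" by (rule finite_subset) simp
  \<comment> \<open>The empty graph has no image for this vertex, so it competes in the maximum,
    which is then attained.\<close>
  moreover have "Inl 0 \<in> verts (complete_bipartite s t)"
    using st by (simp add: complete_bipartite_def)
  then have "is_subgraph ({}, {}) G \<and> \<not> contains_copy ({}, {}) (complete_bipartite s t)"
    by (auto simp: is_subgraph_def simple_graph_def contains_copy_def)
  then have "?N \<noteq> {}" by blast
  ultimately have "ex_number G (complete_bipartite s t) \<in> ?N" unfolding ex_number_def by (rule Max_in)
  then obtain G' where G': "is_subgraph G' G" "\<not> contains_copy G' (complete_bipartite s t)"
    "ex_number G (complete_bipartite s t) = card (edges G')" by auto
  then show ?thesis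
    using that[of "edges G'"] bipfree_edges[OF _ st G'(2)] x by (auto simp: is_subgraph_def)
qed

lemma prob_edges_superset:
  assumes I: "I \<subseteq> A" and A: "finite A" and p: "0 \<le> p" "p \<le> 1"
  shows "measure_pmf.prob (Pi_pmf A False (\<lambda>_. bernoulli_pmf p)) {f. \<forall>e\<in>I. f e} = p ^ card I"
proof -
  let ?B = "\<lambda>e. if e \<in> I then {True} else UNIV"
  have "{f. \<forall>e\<in>I. f e} = Pi A ?B" using I by (auto simp: Pi_def)
  then have "measure_pmf.prob (Pi_pmf A False (\<lambda>_. bernoulli_pmf p)) {f. \<forall>e\<in>I. f e}
      = (\<Prod>e\<in>A. measure_pmf.prob (bernoulli_pmf p) (?B e))"
    using A by (simp add: measure_Pi_pmf_Pi)
  also have "\<dots> = (\<Prod>e\<in>A. if e \<in> I then p else 1)"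
    using p by (intro prod.cong) (auto simp: measure_pmf_single)
  also have "\<dots> = p ^ card I"
    using I A by (simp add: prod.If_cases Int_absorb1)
  finally show ?thesis .
qed

text \<open>Union bound over the free edge sets \<open>I\<close> with more than \<open>x\<close>
  elements, each weakened by \<open>exp (card I - x) \<ge> 1\<close>; this is where the factor
  \<open>exp 1\<close> in \<open>q\<close> comes from. The slack \<open>p \<le> p'\<close> serves
  the range below the threshold.\<close>

lemma prob_ex_number_gt:
  assumes st: "1 \<le> s" "1 \<le> t" and p: "0 \<le> p" "p \<le> 1" "p \<le> p'"
  shows "measure_pmf.prob (gnp n p) {G. x < real (ex_number G (complete_bipartite s t))}
    \<le> exp (- x) * free_sum s t (exp 1 * p') (all_pairs {1..n})"
proof -
  let ?A = "all_pairs {1..n}"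
  let ?M = "Pi_pmf ?A False (\<lambda>_. bernoulli_pmf p)"
  let ?F = "\<lambda>f. ({1..n}, {e \<in> ?A. f e})"
  define \<I> where "\<I> = {I. I \<subseteq> ?A \<and> bipfree s t I \<and> x < real (card I)}"
  have finA: "finite ?A" by (simp add: finite_all_pairs)
  have fin\<I>: "finite \<I>" using finA by (simp add: \<I>_def)
  have "measure_pmf.prob (gnp n p) {G. x < real (ex_number G (complete_bipartite s t))}
      = measure_pmf.prob ?M {f. x < real (ex_number (?F f) (complete_bipartite s t))}"
    by (simp add: gnp_def vimage_def)
  also have "\<dots> \<le> measure_pmf.prob ?M (\<Union>I\<in>\<I>. {f. \<forall>e\<in>I. f e})"
  proof (rule measure_pmf.finite_measure_mono)
    show "{f. x < real (ex_number (?F f) (complete_bipartite s t))} \<subseteq> (\<Union>I\<in>\<I>. {f. \<forall>e\<in>I. f e})"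
    proof
      fix f assume "f \<in> {f. x < real (ex_number (?F f) (complete_bipartite s t))}"
      moreover have "simple_graph (?F f)" by (auto simp: simple_graph_def)
      ultimately obtain I where "I \<subseteq> edges (?F f)" "bipfree s t I" "x < real (card I)"
        using less_ex_numberE[OF _ st] by blast
      then show "f \<in> (\<Union>I\<in>\<I>. {f. \<forall>e\<in>I. f e})" by (auto simp: \<I>_def)
    qed
  qed simp
  also have "\<dots> \<le> (\<Sum>I\<in>\<I>. measure_pmf.prob ?M {f. \<forall>e\<in>I. f e})"
    using fin\<I> by (intro measure_pmf.finite_measure_subadditive_finite) auto
  also have "\<dots> = (\<Sum>I\<in>\<I>. p ^ card I)"
    using finA p by (intro sum.cong prob_edges_superset) (auto simp: \<I>_def)
  also have "\<dots> \<le> (\<Sum>I\<in>\<I>. exp (- x) * (exp 1 * p') ^ card I)"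
  proof (rule sum_mono)
    fix I assume I: "I \<in> \<I>"
    have "1 * p ^ card I \<le> exp (real (card I) - x) * p' ^ card I"
      using I p by (intro mult_mono power_mono) (auto simp: \<I>_def)
    also have "\<dots> = exp (- x) * (exp 1 * p') ^ card I"
      by (simp add: exp_diff exp_minus power_mult_distrib exp_of_nat_mult[symmetric] field_simps)
    finally show "p ^ card I \<le> exp (- x) * (exp 1 * p') ^ card I" by simp
  qed
  also have "\<dots> \<le> exp (- x) * free_sum s t (exp 1 * p') ?A"
    unfolding free_sum_def sum_distrib_left[symmetric] using finA p
    by (intro mult_left_mono sum_mono2) (auto simp: \<I>_def)
  finally show ?thesis .
qed

theorem theorem7p3:
  fixes s t :: nat
  assumes "2 \<le> s" and "s \<le> t"
  shows "\<exists>C::real. C > 0 \<and>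
    (\<forall>p :: nat \<Rightarrow> real. (\<forall>n. 0 \<le> p n \<and> p n \<le> 1) \<longrightarrow>
      whp (\<lambda>n. gnp n (p n))
        (\<lambda>n G. real (ex_number G (complete_bipartite s t)) \<le>
          (if p n \<le> real n powr (- ((real s - 1) / (real s * real t - 1)))
                     * ln (real n) powr (2 * real s / (real s - 1))
           then C * real n powr (2 - (real s + real t - 2) / (real s * real t - 1))
                  * (ln (real n))\<^sup>2
           else C * p n powr ((real s - 1) / real s) * real n powr (2 - 1 / real s))))"
proof -
  have t: "2 \<le> t" using assms by simp
  obtain C where C: "C > 0" and bound: "\<forall>(X :: nat set) p. finite X \<longrightarrow> 3 \<le> card X \<longrightarrow> 0 < p \<longrightarrow> p \<le> 1 \<longrightarrow>
    free_sum s t (exp 1 * p) (all_pairs X) \<le> exp (C *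
      (p powr ((real s - 1) / real s) * real (card X) powr (2 - 1 / real s)
       + real (card X) powr (2 - (real s + real t - 2) / (real s * real t - 1)) * (ln (real (card X)))\<^sup>2))"
    using free_sum_bound[OF assms(1) t] by blast
  define N where "N = real s * real t - 1"
  define \<alpha> where "\<alpha> = (real s - 1) / N"
  define \<beta> where "\<beta> = 2 * real s / (real s - 1)"
  define \<gamma> where "\<gamma> = 2 - (real s + real t - 2) / N"
  have "2 * 2 \<le> real s * real t" using assms(1) t by (intro mult_mono) auto
  then have N: "0 < N" by (simp add: N_def)
  have \<alpha>: "0 < \<alpha>" using N assms by (simp add: \<alpha>_def)
  have \<gamma>: "0 \<le> \<gamma>"
  proof -
    have "real s + real t \<le> real s * real t + 1"
      using assms(1) t mult_nonneg_nonneg[of "real s - 1" "real t - 1"] by (simp add: algebra_simps)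
    then show ?thesis using N by (simp add: \<gamma>_def N_def divide_le_eq)
  qed
  \<comment> \<open>The exponents \<open>\<alpha>\<close> and \<open>\<beta>\<close> are determined
    by the requirement that the two bounds agree at \<open>p0\<close>.\<close>
  define p0 where "p0 n = real n powr (- \<alpha>) * ln (real n) powr \<beta>" for n :: nat
  define Q where "Q n = real n powr \<gamma> * (ln (real n))\<^sup>2" for n :: nat
  have "p0 \<longlonglongrightarrow> 0" unfolding p0_def using \<alpha> by real_asymp
  then have p0_le: "\<forall>\<^sub>F n in sequentially. p0 n \<le> 1"
    by (rule eventually_mono[OF order_tendstoD(2)[of _ _ _ 1]]) auto
  have p0_powr: "p0 n powr ((real s - 1) / real s) * real n powr (2 - 1 / real s) = Q n" if "3 \<le> n" for n
  proof -
    have ln_pos: "0 < ln (real n)" using that by simp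
    have "- \<alpha> * ((real s - 1) / real s) + (2 - 1 / real s) = \<gamma>"
      using N assms by (simp add: \<alpha>_def \<gamma>_def N_def field_simps)
    moreover have "\<beta> * ((real s - 1) / real s) = 2" using assms by (simp add: \<beta>_def)
    ultimately show ?thesis using ln_pos that
      by (simp add: p0_def Q_def powr_mult powr_powr powr_add[symmetric] mult_ac)
  qed
  show ?thesis
  \<comment> \<open>Since \<open>Q n \<le> P n\<close>, the generating function costs at most
    \<open>2 * C * P n\<close> in the exponent. The additional \<open>P n \<ge> ln n\<close> makes
    the failure probability at most \<open>1 / n\<close>.\<close>
  proof (intro exI[of _ "2 * C + 1"] conjI allI impI)
    show "0 < 2 * C + 1" using C by simp
    fix p :: "nat \<Rightarrow> real" assume p: "\<forall>n. 0 \<le> p n \<and> p n \<le> 1"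
    \<comment> \<open>Raising \<open>p\<close> to the threshold makes both cases the single bound
      \<open>(2 * C + 1) * P n\<close>. It also ensures \<open>p' n > 0\<close>, even where
      \<open>p n = 0\<close>; \<open>p' n \<le> 1\<close> holds for large \<open>n\<close> because
      \<open>p0\<close> tends to 0.\<close>
    define p' where "p' n = max (p n) (p0 n)" for n
    define P where "P n = p' n powr ((real s - 1) / real s) * real n powr (2 - 1 / real s)" for n
    define good where "good n = {G :: nat graph. real (ex_number G (complete_bipartite s t)) \<le>
        (if p n \<le> p0 n then (2 * C + 1) * real n powr \<gamma> * (ln (real n))\<^sup>2
         else (2 * C + 1) * p n powr ((real s - 1) / real s) * real n powr (2 - 1 / real s))}" for n
    have ev: "\<forall>\<^sub>F n in sequentially. 1 - 1 / real n \<le> measure_pmf.prob (gnp n (p n)) (good n)"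
      using p0_le eventually_ge_at_top[of 3]
    proof eventually_elim
      case (elim n)
      have ln_n: "1 \<le> ln (real n)"
      proof -
        have "exp 1 \<le> real n" using elim e_less_272 by linarith
        then show ?thesis using elim by (subst ln_ge_iff) auto
      qed
      have p0: "0 < p0 n" using elim ln_n by (auto simp: p0_def)
      have p': "0 < p' n" "p' n \<le> 1" "p n \<le> p' n" "p0 n \<le> p' n" using p0 p elim by (auto simp: p'_def)
      have QP: "Q n \<le> P n"
        unfolding p0_powr[OF elim(2), symmetric] P_def using p0 p' assms
        by (intro mult_right_mono powr_mono2) auto
      have "1 * ln (real n) \<le> real n powr \<gamma> * (ln (real n) * ln (real n))"
        using elim ln_n \<gamma> by (intro mult_mono) (auto simp: ge_one_powr_ge_zero mult_le_cancel_right1)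
      then have lnQ: "ln (real n) \<le> Q n" by (simp add: Q_def power2_eq_square)
      have goodP: "good n = {G. real (ex_number G (complete_bipartite s t)) \<le> (2 * C + 1) * P n}"
      proof (cases "p n \<le> p0 n")
        case True
        then have "P n = Q n" using p0_powr[OF elim(2)] by (simp add: P_def p'_def)
        then show ?thesis using True by (simp add: good_def Q_def mult.assoc)
      next
        case False
        then have "p' n = p n" by (simp add: p'_def)
        then show ?thesis using False by (simp add: good_def P_def mult.assoc)
      qed
      have "measure_pmf.prob (gnp n (p n)) {G. (2 * C + 1) * P n < real (ex_number G (complete_bipartite s t))}
          \<le> exp (- ((2 * C + 1) * P n)) * free_sum s t (exp 1 * p' n) (all_pairs {1..n})"
        using p p' assms t by (intro prob_ex_number_gt) auto
      also have "\<dots> \<le> exp (- ((2 * C + 1) * P n)) * exp (C * (P n + Q n))"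
        using bound[rule_format, of "{1..n}" "p' n"] elim p'
        by (intro mult_left_mono) (auto simp: P_def Q_def \<gamma>_def N_def)
      also have "\<dots> = exp (C * (Q n - P n) - P n)" by (simp add: exp_add[symmetric] algebra_simps)
      also have "\<dots> \<le> exp (- ln (real n))"
        using QP lnQ C mult_nonneg_nonpos[of C "Q n - P n"] by simp
      also have "\<dots> = 1 / real n" using elim by (simp add: exp_minus inverse_eq_divide)
      finally have bad: "measure_pmf.prob (gnp n (p n)) {G. (2 * C + 1) * P n < real (ex_number G (complete_bipartite s t))} \<le> 1 / real n" .
      have "- good n = {G. (2 * C + 1) * P n < real (ex_number G (complete_bipartite s t))}"
        unfolding goodP by auto
      then show ?case using bad measure_pmf.prob_compl[of "good n" "gnp n (p n)"]
        by (simp add: Compl_eq_Diff_UNIV)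
    qed
    have "(\<lambda>n. measure_pmf.prob (gnp n (p n)) (good n)) \<longlonglongrightarrow> 1"
    proof (rule tendsto_sandwich[OF ev])
      show "(\<lambda>n. 1 - 1 / real n) \<longlonglongrightarrow> 1" by real_asymp
    qed auto
    then show "whp (\<lambda>n. gnp n (p n))
        (\<lambda>n G. real (ex_number G (complete_bipartite s t)) \<le>
          (if p n \<le> real n powr (- ((real s - 1) / (real s * real t - 1)))
                     * ln (real n) powr (2 * real s / (real s - 1))
           then (2 * C + 1) * real n powr (2 - (real s + real t - 2) / (real s * real t - 1))
                  * (ln (real n))\<^sup>2
           else (2 * C + 1) * p n powr ((real s - 1) / real s) * real n powr (2 - 1 / real s)))"
      unfolding whp_def good_def p0_def \<alpha>_def \<beta>_def \<gamma>_def N_def .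
  qed
qed

end
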